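(* Let $Q=(\triangle_{D_{n+1}},\xi)$ be a Dynkin quiver of type $D_{n+1}$ with $\xi_n=\xi_{n+1}$ (i.e. $Q$ is $\vee$-fixed), and let $\overline Q=(\triangle_{B_n},\overline\xi)$ be the Dynkin quiver of type $B_n$ with $\overline\xi_i=\xi_i$ for $1\le i\le n$. Then the AR-quiver $\Gamma_{\overline Q}$ with its labeling by $\Phi^+_{B_n}$ is obtained from the AR-quiver $\Gamma_Q$ with its labeling by $\Phi^+_{D_{n+1}}$ by the following surgery: (1) remove all vertices of $\Gamma_Q$ located at residue $n+1$ (i.e. of the form $(n+1,p)$); (2) replace every label $\langle a,\pm(n+1)\rangle$ at residue $n$ by $\langle a\rangle$ (all the other labels $\langle a,\pm b\rangle$, $1\le a<b\le n$, being kept). That is, $(\Gamma_{\overline Q})_0=\{(i,p)\in(\Gamma_Q)_0\mid i\le n\}$, and the labels are related as described.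
   Context: **Dynkin quivers.** For a finite Dynkin diagram $\triangle$ with vertex set $I$, fundamental weights $\varpi_i$, Coxeter number $\mathsf h$, and involution $i\mapsto i^*$ ($w_0\alpha_i=-\alpha_{i^*}$), a Dynkin quiver $Q=(\triangle,\xi)$ is given by a height function $\xi:I\to\mathbb Z$ with $|\xi_i-\xi_j|=1$ for adjacent $i,j$. $i$ is a source if $\xi_i>\xi_j$ for all neighbours $j$; then $s_iQ=(\triangle,s_i\xi)$, $(s_i\xi)_j=\xi_j-2\delta_{i,j}$. A reduced expression $s_{i_1}\cdots s_{i_l}$ is $Q$-adapted if $i_k$ is a source of $s_{i_{k-1}}\cdots s_{i_1}Q$ for all $k$. $\tau_Q$ is the unique Coxeter element all of whose reduced expressions are $Q$-adapted; $\gamma_i^Q=(1-\tau_Q)\varpi_i\in\Phi^+$. The AR-quiver $\Gamma_Q$ has vertex set $(\Gamma_Q)_0=\{(i,p)\in I\times\mathbb Z\mid p-\xi_i\in2\mathbb Z,\ \xi_{i^*}-\mathsf h<p\le\xi_i\}$ and $-\langle h_i,\alpha_j\rangle$ arrows $(i,p)\to(j,p+1)$ for adjacent $i,j$; the vertex $(i,p)$ has residue $i$ and is labeled by the positive root $\phi_Q(i,p)=\tau_Q^{(\xi_i-p)/2}(\gamma_i^Q)$; $\phi_Q$ is a bijection $(\Gamma_Q)_0\to\Phi^+$. **Type $D_{n+1}$.** Nodes $1,\dots,n+1$, with $1-2-\cdots-(n-1)$ a chain and $n,n+1$ both attached to $n-1$; $\alpha_i=\epsilon_i-\epsilon_{i+1}$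 ($i\le n$), $\alpha_{n+1}=\epsilon_n+\epsilon_{n+1}$; positive roots $\langle a,\pm b\rangle=\epsilon_a\pm\epsilon_b$, $1\le a<b\le n+1$. $\vee$ exchanges $n$ and $n+1$ and fixes the other nodes. **Type $B_n$.** Nodes $1,\dots,n$ in a chain, $\alpha_n$ short; $\alpha_i=\varepsilon_i-\varepsilon_{i+1}$ ($i<n$), $\alpha_n=\varepsilon_n$, with the $\varepsilon_i$ orthogonal of equal length; positive roots $\langle a,\pm b\rangle=\varepsilon_a\pm\varepsilon_b$ ($1\le a<b\le n$) and $\langle a\rangle=\varepsilon_a$ ($1\le a\le n$). *)

theory Defs
  imports Complex_Main
begin

section \<open>Dynkin data in coordinates\<close>

text \<open>
  Vectors of the Euclidean space with orthonormal basis \<open>eps 1, \<dots>, eps N\<close> are coordinate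
  functions \<open>nat \<Rightarrow> real\<close>, so that the rank may vary inside one statement. The inner product
  only sees the coordinates \<open>1..N\<close>, and the simple roots of the data below are supported there.
\<close>

type_synonym vec = "nat \<Rightarrow> real"

record dynkin =
  ambient_dim :: nat
  nodes :: "nat set"
  simple_root :: "nat \<Rightarrow> vec"

definition inner_prod :: "dynkin \<Rightarrow> vec \<Rightarrow> vec \<Rightarrow> real" where
  "inner_prod C u v = (\<Sum>k = 1..ambient_dim C. u k * v k)"

text \<open>The pairing of \<open>v\<close> with the simple coroot \<open>h\<^sub>i\<close>; on simple roots it is the Cartan matrix.\<close>

definition coroot_pairing :: "dynkin \<Rightarrow> nat \<Rightarrow> vec \<Rightarrow> real" where
  "coroot_pairing C i v =
     2 * inner_prod C (simple_root C i) v / inner_prod C (simple_root C i) (simple_root C i)"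

definition adjacent :: "dynkin \<Rightarrow> nat \<Rightarrow> nat \<Rightarrow> bool" where
  "adjacent C i j \<longleftrightarrow> i \<in> nodes C \<and> j \<in> nodes C \<and> i \<noteq> j \<and> coroot_pairing C i (simple_root C j) \<noteq> 0"

definition fundamental_weight :: "dynkin \<Rightarrow> nat \<Rightarrow> vec" where
  "fundamental_weight C i =
     (THE v. (\<exists>c. v = (\<lambda>k. \<Sum>j\<in>nodes C. c j * simple_root C j k)) \<and>
             (\<forall>j\<in>nodes C. coroot_pairing C j v = (if j = i then 1 else 0)))"


section \<open>Weyl group, Coxeter number and the involution of the diagram\<close>

definition simple_reflection :: "dynkin \<Rightarrow> nat \<Rightarrow> vec \<Rightarrow> vec" where
  "simple_reflection C i v = (\<lambda>k. v k - coroot_pairing C i v * simple_root C i k)"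

text \<open>The word \<open>[i\<^sub>1, \<dots>, i\<^sub>l]\<close> stands for the expression \<open>s\<^sub>i\<^sub>1 \<circ> \<cdots> \<circ> s\<^sub>i\<^sub>l\<close>.\<close>

definition word_element :: "dynkin \<Rightarrow> nat list \<Rightarrow> vec \<Rightarrow> vec" where
  "word_element C ws = foldr (\<lambda>i f. simple_reflection C i \<circ> f) ws id"

definition weyl_group :: "dynkin \<Rightarrow> (vec \<Rightarrow> vec) set" where
  "weyl_group C = word_element C ` lists (nodes C)"

definition weyl_length :: "dynkin \<Rightarrow> (vec \<Rightarrow> vec) \<Rightarrow> nat" where
  "weyl_length C w = (LEAST l. \<exists>ws\<in>lists (nodes C). length ws = l \<and> word_element C ws = w)"

definition reduced_expression :: "dynkin \<Rightarrow> nat list \<Rightarrow> (vec \<Rightarrow> vec) \<Rightarrow> bool" where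
  "reduced_expression C ws w \<longleftrightarrow>
     ws \<in> lists (nodes C) \<and> word_element C ws = w \<and> length ws = weyl_length C w"

definition longest_element :: "dynkin \<Rightarrow> vec \<Rightarrow> vec" where
  "longest_element C =
     (THE w. w \<in> weyl_group C \<and> (\<forall>v\<in>weyl_group C. weyl_length C v \<le> weyl_length C w))"

definition involution :: "dynkin \<Rightarrow> nat \<Rightarrow> nat" where
  "involution C i =
     (THE j. j \<in> nodes C \<and> longest_element C (simple_root C i) = (\<lambda>k. - simple_root C j k))"

definition coxeter_element :: "dynkin \<Rightarrow> (vec \<Rightarrow> vec) \<Rightarrow> bool" where
  "coxeter_element C t \<longleftrightarrow> (\<exists>ws. distinct ws \<and> set ws = nodes C \<and> t = word_element C ws)"

text \<open>
  The Coxeter number is the order of a Coxeter element. All Coxeter elements are conjugate, so it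
  does not matter that the nodes are multiplied in increasing order here.
\<close>

definition coxeter_number :: "dynkin \<Rightarrow> nat" where
  "coxeter_number C =
     (LEAST k. 0 < k \<and> word_element C (sorted_list_of_set (nodes C)) ^^ k = id)"


section \<open>Dynkin quivers and their AR-quivers\<close>

text \<open>A Dynkin quiver is a diagram with a height function; only the values of \<open>\<xi>\<close> on the nodes matter.\<close>

definition dynkin_quiver :: "dynkin \<Rightarrow> (nat \<Rightarrow> int) \<Rightarrow> bool" where
  "dynkin_quiver C \<xi> \<longleftrightarrow> (\<forall>i j. adjacent C i j \<longrightarrow> \<bar>\<xi> i - \<xi> j\<bar> = 1)"

definition is_source :: "dynkin \<Rightarrow> (nat \<Rightarrow> int) \<Rightarrow> nat \<Rightarrow> bool" where
  "is_source C \<xi> i \<longleftrightarrow> i \<in> nodes C \<and> (\<forall>j. adjacent C i j \<longrightarrow> \<xi> i > \<xi> j)"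

definition reflect_height :: "nat \<Rightarrow> (nat \<Rightarrow> int) \<Rightarrow> nat \<Rightarrow> int" where
  "reflect_height i \<xi> = (\<lambda>j. \<xi> j - (if i = j then 2 else 0))"

primrec adapted :: "dynkin \<Rightarrow> (nat \<Rightarrow> int) \<Rightarrow> nat list \<Rightarrow> bool" where
  "adapted C \<xi> [] \<longleftrightarrow> True"
| "adapted C \<xi> (i # ws) \<longleftrightarrow> is_source C \<xi> i \<and> adapted C (reflect_height i \<xi>) ws"

definition quiver_coxeter :: "dynkin \<Rightarrow> (nat \<Rightarrow> int) \<Rightarrow> vec \<Rightarrow> vec" where
  "quiver_coxeter C \<xi> =
     (THE t. coxeter_element C t \<and> (\<forall>ws. reduced_expression C ws t \<longrightarrow> adapted C \<xi> ws))"

definition gamma_root :: "dynkin \<Rightarrow> (nat \<Rightarrow> int) \<Rightarrow> nat \<Rightarrow> vec" where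
  "gamma_root C \<xi> i =
     (\<lambda>k. fundamental_weight C i k - quiver_coxeter C \<xi> (fundamental_weight C i) k)"

definition ar_vertices :: "dynkin \<Rightarrow> (nat \<Rightarrow> int) \<Rightarrow> (nat \<times> int) set" where
  "ar_vertices C \<xi> =
     {(i, p). i \<in> nodes C \<and> even (p - \<xi> i) \<and>
              \<xi> (involution C i) - int (coxeter_number C) < p \<and> p \<le> \<xi> i}"

text \<open>The number of arrows between two vertices.\<close>

definition ar_arrows :: "dynkin \<Rightarrow> (nat \<Rightarrow> int) \<Rightarrow> nat \<times> int \<Rightarrow> nat \<times> int \<Rightarrow> nat" where
  "ar_arrows C \<xi> x y =
     (if x \<in> ar_vertices C \<xi> \<and> y \<in> ar_vertices C \<xi> \<and> adjacent C (fst x) (fst y) \<and> snd y = snd x + 1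
      then nat \<lfloor>- coroot_pairing C (fst x) (simple_root C (fst y))\<rfloor> else 0)"

definition ar_label :: "dynkin \<Rightarrow> (nat \<Rightarrow> int) \<Rightarrow> nat \<times> int \<Rightarrow> vec" where
  "ar_label C \<xi> x =
     (quiver_coxeter C \<xi> ^^ nat ((\<xi> (fst x) - snd x) div 2)) (gamma_root C \<xi> (fst x))"


section \<open>The types D and B\<close>

definition eps :: "nat \<Rightarrow> vec" where
  "eps a = (\<lambda>k. if k = a then 1 else 0)"

text \<open>
  For \<open>\<sigma> = 1\<close> and \<open>\<sigma> = -1\<close> these are the roots \<open>\<langle>a, b\<rangle>\<close> and \<open>\<langle>a, -b\<rangle>\<close>. The same
  coordinates are used for the two (unrelated) ambient spaces of type D and of type B.
\<close>

definition root_pair :: "nat \<Rightarrow> real \<Rightarrow> nat \<Rightarrow> vec" where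
  "root_pair a \<sigma> b = (\<lambda>k. eps a k + \<sigma> * eps b k)"

text \<open>\<open>type_D_Suc n\<close> is the type D of rank \<open>n + 1\<close>; for \<open>n = 2\<close> it is the diagram of type A of rank 3.\<close>

definition type_D_Suc :: "nat \<Rightarrow> dynkin" where
  "type_D_Suc n = \<lparr>ambient_dim = n + 1, nodes = {1..n + 1},
     simple_root = (\<lambda>i. if i = n + 1 then root_pair n 1 (n + 1) else root_pair i (-1) (i + 1))\<rparr>"

definition type_B :: "nat \<Rightarrow> dynkin" where
  "type_B n = \<lparr>ambient_dim = n, nodes = {1..n},
     simple_root = (\<lambda>i. if i = n then eps n else root_pair i (-1) (i + 1))\<rparr>"

end

theory Submission
  imports Defs
begin

text \<open>
  A Coxeter element of type B, with the simple reflections in any order, permutes the vectors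
  \<open>\<plusminus>eps a\<close> in one negacyclic cycle, so its \<open>n\<close>-th power is \<open>-1\<close>. The \<open>n\<close>-fold repetition of an
  adapted word then has \<open>n\<^sup>2\<close> letters and inverts all \<open>n\<^sup>2\<close> positive roots, hence it is reduced;
  the roots produced along it are the labels \<open>\<tau>\<^sup>k \<gamma>\<^sub>i\<close> with \<open>k < n\<close>, which are therefore positive.
  Since \<open>\<xi> n = \<xi> (n + 1)\<close>, replacing the letter \<open>n\<close> by the two letters \<open>n, n + 1\<close> turns an adapted
  word of type B into one of type D. The product of these two reflections negates the coordinates
  \<open>n\<close> and \<open>n + 1\<close>, so the Coxeter element of type D acts as that of type B on the first \<open>n\<close>
  coordinates and negates the last one. As \<open>\<gamma>\<^sub>n\<close> changes only by \<open>-eps (n + 1)\<close> and the other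
  \<open>\<gamma>\<^sub>i\<close> not at all, the labels agree except for an extra \<open>\<plusminus>eps (n + 1)\<close> at residue \<open>n\<close>.
\<close>

section \<open>Words in simple reflections\<close>

lemma inner_prod_commute: "inner_prod C u v = inner_prod C v u"
  by (simp add: inner_prod_def mult.commute)

lemma inner_prod_lincomb:
  "inner_prod C u (\<lambda>k. a * v k + b * w k) = a * inner_prod C u v + b * inner_prod C u w"
  by (simp add: inner_prod_def sum.distrib sum_distrib_left algebra_simps)

lemma inner_prod_eps: "a \<in> {1..ambient_dim C} \<Longrightarrow> inner_prod C (eps a) v = v a"
  by (simp add: inner_prod_def eps_def if_distrib[where f = "\<lambda>x. x * _"] cong: if_cong)

lemma inner_prod_root_pair:
  assumes "a \<in> {1..ambient_dim C}" "b \<in> {1..ambient_dim C}"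
  shows "inner_prod C (root_pair a \<sigma> b) v = v a + \<sigma> * v b"
proof -
  have "inner_prod C (root_pair a \<sigma> b) v = inner_prod C v (\<lambda>k. 1 * eps a k + \<sigma> * eps b k)"
    by (simp add: root_pair_def inner_prod_commute)
  also have "\<dots> = v a + \<sigma> * v b"
    unfolding inner_prod_lincomb using assms by (simp add: inner_prod_commute[of C v] inner_prod_eps)
  finally show ?thesis .
qed

lemma inner_prod_sum_right:
  "inner_prod C u (\<lambda>k. \<Sum>j\<in>A. c j * v j k) = (\<Sum>j\<in>A. c j * inner_prod C u (v j))"
  unfolding inner_prod_def sum_distrib_left
  by (subst sum.swap) (simp add: algebra_simps)

lemma coroot_pairing_lincomb:
  "coroot_pairing C i (\<lambda>k. a * v k + b * w k) = a * coroot_pairing C i v + b * coroot_pairing C i w"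
  by (simp add: coroot_pairing_def inner_prod_lincomb add_divide_distrib algebra_simps)

lemma simple_reflection_lincomb:
  "simple_reflection C i (\<lambda>k. a * u k + b * v k)
    = (\<lambda>k. a * simple_reflection C i u k + b * simple_reflection C i v k)"
  by (rule ext) (simp add: simple_reflection_def coroot_pairing_lincomb algebra_simps)

lemma word_element_Nil [simp]: "word_element C [] = id"
  by (simp add: word_element_def)

lemma word_element_Cons [simp]:
  "word_element C (i # ws) = simple_reflection C i \<circ> word_element C ws"
  by (simp add: word_element_def)

lemma word_element_append [simp]:
  "word_element C (us @ vs) = word_element C us \<circ> word_element C vs"
  by (induction us) (simp_all add: comp_assoc)

lemma word_element_snoc: "word_element C (ws @ [i]) = word_element C ws \<circ> simple_reflection C i"
  by (simp add: fun_eq_iff)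

lemma word_element_power:
  "word_element C ws ^^ k = word_element C (concat (replicate k ws))"
  by (induction k) simp_all

lemma word_element_lincomb:
  "word_element C ws (\<lambda>k. a * u k + b * v k)
    = (\<lambda>k. a * word_element C ws u k + b * word_element C ws v k)"
  by (induction ws) (simp_all add: simple_reflection_lincomb)

lemma word_element_scale:
  "word_element C ws (\<lambda>k. a * u k) = (\<lambda>k. a * word_element C ws u k)"
  using word_element_lincomb[of C ws a u 0 u] by simp

lemma word_element_uminus:
  "word_element C ws (\<lambda>k. - u k) = (\<lambda>k. - word_element C ws u k)"
  using word_element_scale[of C ws "-1" u] by simp

lemma word_element_diff:
  "word_element C ws (\<lambda>k. u k - v k) = (\<lambda>k. word_element C ws u k - word_element C ws v k)"
  using word_element_lincomb[of C ws 1 u "-1" v] by simp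

lemma simple_reflection_uminus:
  "simple_reflection C i (\<lambda>k. - u k) = (\<lambda>k. - simple_reflection C i u k)"
  using word_element_uminus[of C "[i]"] by simp

text \<open>A \<open>vec\<close> also has coordinates outside \<open>{1..ambient_dim C}\<close>,
  which \<open>inner_prod\<close> ignores. The supported functions are the genuine vectors of the
  Euclidean space; among these the inner product is definite.\<close>

definition supported :: "dynkin \<Rightarrow> vec \<Rightarrow> bool" where
  "supported C v \<longleftrightarrow> (\<forall>k. k \<notin> {1..ambient_dim C} \<longrightarrow> v k = 0)"

definition root_span :: "dynkin \<Rightarrow> vec set" where
  "root_span C = {v. \<exists>c. v = (\<lambda>k. \<Sum>j\<in>nodes C. c j * simple_root C j k)}"

lemma root_span_lincomb:
  assumes "u \<in> root_span C" "v \<in> root_span C"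
  shows "(\<lambda>k. a * u k + b * v k) \<in> root_span C"
proof -
  obtain c d where "u = (\<lambda>k. \<Sum>j\<in>nodes C. c j * simple_root C j k)"
    "v = (\<lambda>k. \<Sum>j\<in>nodes C. d j * simple_root C j k)"
    using assms by (auto simp: root_span_def)
  then show ?thesis
    unfolding root_span_def
    by (intro CollectI exI[of _ "\<lambda>j. a * c j + b * d j"])
      (simp add: sum_distrib_left sum.distrib algebra_simps)
qed

lemma simple_root_in_span:
  "finite (nodes C) \<Longrightarrow> i \<in> nodes C \<Longrightarrow> simple_root C i \<in> root_span C"
  unfolding root_span_def
  by (intro CollectI exI[of _ "\<lambda>j. if j = i then 1 else 0"])
    (simp add: if_distrib[where f = "\<lambda>x. x * _"] cong: if_cong)

text \<open>What types B and D share: an obtuse system of simple roots that spans the ambient space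
  (\<open>eps_in_span\<close>) and has a dual family (\<open>ex_weight\<close>), which makes the
  roots linearly independent.\<close>

locale dynkin_datum =
  fixes C :: dynkin
  assumes finite_nodes: "finite (nodes C)"
    and supported_root: "i \<in> nodes C \<Longrightarrow> supported C (simple_root C i)"
    and root_norm_pos: "i \<in> nodes C \<Longrightarrow> inner_prod C (simple_root C i) (simple_root C i) > 0"
    and root_inner_nonpos: "i \<in> nodes C \<Longrightarrow> j \<in> nodes C \<Longrightarrow> i \<noteq> j \<Longrightarrow>
          inner_prod C (simple_root C i) (simple_root C j) \<le> 0"
    and eps_in_span: "a \<in> {1..ambient_dim C} \<Longrightarrow> eps a \<in> root_span C"
    and ex_weight: "i \<in> nodes C \<Longrightarrow>
          \<exists>v. supported C v \<and> (\<forall>j\<in>nodes C. coroot_pairing C j v = (if j = i then 1 else 0))"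
begin

abbreviation "\<alpha> \<equiv> simple_root C"
abbreviation "s \<equiv> simple_reflection C"
abbreviation "W \<equiv> word_element C"
abbreviation "\<omega> \<equiv> fundamental_weight C"

section \<open>Reflections as isometries, fundamental weights\<close>

lemma pairing_root_self: "i \<in> nodes C \<Longrightarrow> coroot_pairing C i (\<alpha> i) = 2"
  using root_norm_pos[of i] by (simp add: coroot_pairing_def)

lemma pairing_root_nonpos:
  "i \<in> nodes C \<Longrightarrow> j \<in> nodes C \<Longrightarrow> i \<noteq> j \<Longrightarrow> coroot_pairing C i (\<alpha> j) \<le> 0"
  using root_inner_nonpos[of i j] root_norm_pos[of i]
  by (simp add: coroot_pairing_def divide_le_0_iff)

lemma pairing_eq_0_iff:
  "i \<in> nodes C \<Longrightarrow> coroot_pairing C i v = 0 \<longleftrightarrow> inner_prod C (\<alpha> i) v = 0"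
  using root_norm_pos[of i] by (simp add: coroot_pairing_def)

lemma adjacent_sym: "adjacent C i j \<longleftrightarrow> adjacent C j i"
  unfolding adjacent_def using pairing_eq_0_iff inner_prod_commute by metis

lemma simple_reflection_root: "i \<in> nodes C \<Longrightarrow> s i (\<alpha> i) = (\<lambda>k. - \<alpha> i k)"
  by (rule ext) (simp add: simple_reflection_def pairing_root_self)

lemma simple_reflection_involutive: "i \<in> nodes C \<Longrightarrow> s i (s i v) = v"
proof (rule ext)
  fix k assume i: "i \<in> nodes C"
  have "coroot_pairing C i (s i v) = - coroot_pairing C i v"
    using coroot_pairing_lincomb[of C i 1 v "- coroot_pairing C i v" "\<alpha> i"] i
    by (simp add: simple_reflection_def pairing_root_self)
  then show "s i (s i v) k = v k"
    by (simp add: simple_reflection_def[of C i "s i v"]) (simp add: simple_reflection_def)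
qed

lemma inner_prod_reflection:
  assumes "i \<in> nodes C" shows "inner_prod C (s i u) (s i v) = inner_prod C u v"
proof -
  let ?a = "inner_prod C (\<alpha> i) (\<alpha> i)"
  let ?p = "coroot_pairing C i"
  have lin: "inner_prod C x (s i y) = inner_prod C x y - ?p y * inner_prod C x (\<alpha> i)" for x y
    using inner_prod_lincomb[of C x 1 y "- ?p y" "\<alpha> i"] by (simp add: simple_reflection_def)
  have p: "?p x * ?a = 2 * inner_prod C x (\<alpha> i)" for x
    using root_norm_pos[OF assms] by (simp add: coroot_pairing_def inner_prod_commute)
  have "inner_prod C (s i u) (s i v) = inner_prod C (s i u) v - ?p v * inner_prod C (s i u) (\<alpha> i)"
    by (rule lin)
  also have "\<dots> = inner_prod C v u - ?p u * inner_prod C v (\<alpha> i)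
      - ?p v * (inner_prod C (\<alpha> i) u - ?p u * ?a)"
    by (simp add: lin inner_prod_commute[of C "s i u"])
  also have "\<dots> = inner_prod C u v"
  proof -
    \<comment> \<open>Each of the two cross terms is half of \<open>?p v * (?p u * ?a)\<close>, so
      together they cancel that quadratic term.\<close>
    have "2 * (?p v * inner_prod C u (\<alpha> i)) = ?p v * (?p u * ?a)"
      "2 * (?p u * inner_prod C v (\<alpha> i)) = ?p u * (?p v * ?a)"
      unfolding p by simp_all
    then have "?p v * inner_prod C u (\<alpha> i) = ?p u * inner_prod C v (\<alpha> i)"
      "?p v * (?p u * ?a) = 2 * (?p u * inner_prod C v (\<alpha> i))"
      by (simp_all only: mult.left_commute[of "?p v" "?p u" ?a])
    then show ?thesis
      by (simp add: inner_prod_commute[of C "\<alpha> i" u] inner_prod_commute[of C v u] right_diff_distrib)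
  qed
  finally show ?thesis .
qed

lemma inner_prod_word: "set ws \<subseteq> nodes C \<Longrightarrow> inner_prod C (W ws u) (W ws v) = inner_prod C u v"
  by (induction ws) (simp_all add: inner_prod_reflection)

lemma supported_in_span:
  assumes "supported C v"
  shows "\<exists>c. v = (\<lambda>k. \<Sum>j\<in>nodes C. c j * \<alpha> j k)"
proof -
  obtain c where c: "eps a = (\<lambda>k. \<Sum>j\<in>nodes C. c a j * \<alpha> j k)"
    if "a \<in> {1..ambient_dim C}" for a
    using eps_in_span unfolding root_span_def mem_Collect_eq by metis
  have "v k = (\<Sum>j\<in>nodes C. (\<Sum>a = 1..ambient_dim C. v a * c a j) * \<alpha> j k)" for k
  proof -
    have "v k = (\<Sum>a = 1..ambient_dim C. v a * eps a k)"
      using assms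
      by (cases "k \<in> {1..ambient_dim C}")
        (auto simp: supported_def eps_def if_distrib[where f = "\<lambda>x. _ * x"] cong: if_cong)
    also have "\<dots> = (\<Sum>a = 1..ambient_dim C. \<Sum>j\<in>nodes C. v a * c a j * \<alpha> j k)"
      by (rule sum.cong) (simp_all add: c sum_distrib_left mult.assoc)
    also have "\<dots> = (\<Sum>j\<in>nodes C. (\<Sum>a = 1..ambient_dim C. v a * c a j) * \<alpha> j k)"
      by (subst sum.swap) (simp add: sum_distrib_right)
    finally show ?thesis .
  qed
  then show ?thesis
    by (intro exI[of _ "\<lambda>j. \<Sum>a = 1..ambient_dim C. v a * c a j"] ext)
qed

text \<open>The difference of two candidates lies in the span of the simple roots and is orthogonal
  to each of them. Its norm is therefore 0, and being supported it vanishes.\<close>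

lemma fundamental_weight_eqI:
  assumes "supported C v" "\<forall>j\<in>nodes C. coroot_pairing C j v = (if j = i then 1 else 0)"
  shows "\<omega> i = v"
  unfolding fundamental_weight_def
proof (rule the_equality)
  show "(\<exists>c. v = (\<lambda>k. \<Sum>j\<in>nodes C. c j * \<alpha> j k)) \<and>
    (\<forall>j\<in>nodes C. coroot_pairing C j v = (if j = i then 1 else 0))"
    using supported_in_span assms by blast
next
  fix w
  assume w: "(\<exists>c. w = (\<lambda>k. \<Sum>j\<in>nodes C. c j * \<alpha> j k)) \<and>
    (\<forall>j\<in>nodes C. coroot_pairing C j w = (if j = i then 1 else 0))"
  then have supp_w: "supported C w"
    using supported_root by (auto simp: supported_def intro!: sum.neutral)
  define d where "d = (\<lambda>k. 1 * w k + (-1) * v k)"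
  have supp_d: "supported C d" using supp_w assms(1) by (auto simp: supported_def d_def)
  then obtain c where c: "d = (\<lambda>k. \<Sum>j\<in>nodes C. c j * \<alpha> j k)"
    using supported_in_span by blast
  have "inner_prod C (\<alpha> j) d = 0" if "j \<in> nodes C" for j
    using that w assms(2) pairing_eq_0_iff[of j d]
    unfolding d_def coroot_pairing_lincomb by simp
  then have "inner_prod C d d = 0"
    by (subst (2) c) (simp add: inner_prod_sum_right inner_prod_commute[of C d])
  then have "\<forall>k\<in>{1..ambient_dim C}. d k = 0"
    unfolding inner_prod_def by (subst (asm) sum_nonneg_eq_0_iff) auto
  then have "d k = 0" for k using supp_d by (auto simp: supported_def)
  then show "w = v" by (auto simp: d_def)
qed

lemma pairing_weight:
  assumes "i \<in> nodes C" "j \<in> nodes C"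
  shows "coroot_pairing C j (\<omega> i) = (if j = i then 1 else 0)"
  using ex_weight[OF assms(1)] fundamental_weight_eqI assms(2) by metis

lemma inj_simple_root: "inj_on \<alpha> (nodes C)"
proof (rule inj_onI)
  fix i j assume ij: "i \<in> nodes C" "j \<in> nodes C" "\<alpha> i = \<alpha> j"
  then have "coroot_pairing C i (\<omega> i) = coroot_pairing C j (\<omega> i)" by (simp add: coroot_pairing_def)
  then show "i = j" using ij by (simp add: pairing_weight split: if_splits)
qed

lemma word_fixes_weight:
  assumes "i \<in> nodes C" "set ws \<subseteq> nodes C" "i \<notin> set ws"
  shows "W ws (\<omega> i) = \<omega> i"
  using assms(2,3)
  by (induction ws) (auto simp: simple_reflection_def pairing_weight assms(1))

text \<open>The letters in \<open>vs\<close> fix \<open>\<omega> j\<close>, the letter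
  \<open>j\<close> subtracts \<open>\<alpha> j\<close>, and the letters in \<open>us\<close> fix
  \<open>\<omega> j\<close> again while moving \<open>\<alpha> j\<close>. This is the source of the
  explicit formula for the roots \<gamma>.\<close>

lemma weight_minus_word:
  assumes "set (us @ j # vs) \<subseteq> nodes C" "j \<notin> set us" "j \<notin> set vs"
  shows "W (us @ j # vs) (\<omega> j) = (\<lambda>k. \<omega> j k - W us (\<alpha> j) k)"
proof -
  have "s j (\<omega> j) = (\<lambda>k. \<omega> j k - \<alpha> j k)"
    using assms(1) by (simp add: simple_reflection_def pairing_weight)
  then show ?thesis
    using assms by (simp add: word_fixes_weight word_element_diff)
qed

section \<open>Coxeter elements and adapted words\<close>

definition full_word :: "nat list \<Rightarrow> bool" where
  "full_word ws \<longleftrightarrow> distinct ws \<and> set ws = nodes C"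

lemma word_root_nonzero:
  assumes "j \<in> nodes C" "set us \<subseteq> nodes C" shows "W us (\<alpha> j) \<noteq> (\<lambda>k. 0)"
proof
  assume "W us (\<alpha> j) = (\<lambda>k. 0)"
  then have "inner_prod C (\<alpha> j) (\<alpha> j) = 0"
    using inner_prod_word[OF assms(2), of "\<alpha> j" "\<alpha> j"] by (simp add: inner_prod_def)
  then show False using root_norm_pos assms(1) by force
qed

text \<open>A word without the letter \<open>j\<close> fixes \<open>\<omega> j\<close>, whereas a
  full word moves it by an image of \<open>\<alpha> j\<close>, which is nonzero.\<close>

lemma word_eq_full_word:
  assumes "full_word ws" "set us \<subseteq> nodes C" "W us = W ws"
  shows "set us = nodes C"
proof (rule ccontr)
  assume "set us \<noteq> nodes C"
  then obtain j where j: "j \<in> nodes C" "j \<notin> set us" using assms(2) by blast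
  then obtain as bs where ws: "ws = as @ j # bs" "j \<notin> set as" "j \<notin> set bs"
    using assms(1) unfolding full_word_def
    by (metis distinct.simps(2) distinct_append not_distinct_conv_prefix split_list_first)
  have "W ws (\<omega> j) = (\<lambda>k. \<omega> j k - W as (\<alpha> j) k)"
    unfolding ws(1) using assms(1) ws by (intro weight_minus_word) (auto simp: full_word_def)
  moreover have "W ws (\<omega> j) = \<omega> j"
    using word_fixes_weight[OF j(1) assms(2) j(2)] assms(3) by simp
  ultimately have "\<omega> j k - W as (\<alpha> j) k = \<omega> j k" for k by (metis (full_types))
  then have "W as (\<alpha> j) = (\<lambda>k. 0)" by (auto simp: fun_eq_iff)
  then show False
    using word_root_nonzero[of j as] j ws assms(1) by (auto simp: full_word_def)
qed

text \<open>Any word for a Coxeter element contains every node, so its least possible length is the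
  rank, attained exactly when no letter is repeated.\<close>

lemma reduced_expression_full_word:
  assumes "full_word ws"
  shows "reduced_expression C us (W ws) \<longleftrightarrow> full_word us \<and> W us = W ws"
proof -
  have card: "card (nodes C) \<le> length us"
    if "set us \<subseteq> nodes C" "W us = W ws" for us
    using word_eq_full_word[OF assms that] card_length[of us] by simp
  have len: "length ws = card (nodes C)"
    using assms distinct_card unfolding full_word_def by metis
  have "weyl_length C (W ws) = card (nodes C)"
    unfolding weyl_length_def
    by (rule Least_equality) (use assms card len in \<open>auto simp: full_word_def in_lists_conv_set\<close>)
  then show ?thesis
    using word_eq_full_word[OF assms, of us] card_distinct[of us] distinct_card[of us]
    unfolding reduced_expression_def full_word_def by (auto simp: subset_iff)
qed

text \<open>The letters of \<open>us\<close> add to \<open>\<alpha> j\<close> nonnegative multiples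
  of simple roots other than \<open>\<alpha> k\<close>, and those pair nonpositively with the coroot
  of \<open>k\<close>.\<close>

lemma pairing_word_root_le:
  assumes "set us \<subseteq> nodes C" "distinct us" "j \<in> nodes C" "j \<notin> set us"
    and "k \<in> nodes C" "k \<noteq> j" "k \<notin> set us"
  shows "coroot_pairing C k (W us (\<alpha> j)) \<le> coroot_pairing C k (\<alpha> j)"
  using assms
proof (induction us arbitrary: k)
  case (Cons i us)
  let ?v = "W us (\<alpha> j)"
  \<comment> \<open>The induction hypothesis is used at the prepended node \<open>i\<close> as well
    as at \<open>k\<close>, which is why \<open>k\<close> is kept arbitrary.\<close>
  have "coroot_pairing C i ?v \<le> 0"
    using Cons.IH[of i] Cons.prems pairing_root_nonpos[of i j] by auto
  moreover have "coroot_pairing C k (\<alpha> i) \<le> 0"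
    using Cons.prems pairing_root_nonpos[of k i] by auto
  ultimately have "coroot_pairing C i ?v * coroot_pairing C k (\<alpha> i) \<ge> 0"
    by (rule mult_nonpos_nonpos)
  moreover have "coroot_pairing C k (s i ?v)
      = coroot_pairing C k ?v - coroot_pairing C i ?v * coroot_pairing C k (\<alpha> i)"
    using coroot_pairing_lincomb[of C k 1 ?v "- coroot_pairing C i ?v" "\<alpha> i"]
    by (simp add: simple_reflection_def)
  ultimately show ?case using Cons.IH[of k] Cons.prems by auto
qed simp

lemma inner_weight_root:
  assumes "k \<in> nodes C" "i \<in> nodes C"
  shows "inner_prod C (\<omega> k) (\<alpha> i) = (if i = k then inner_prod C (\<alpha> k) (\<alpha> k) / 2 else 0)"
  using pairing_weight[OF assms] root_norm_pos[of i] assms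
  by (auto simp: coroot_pairing_def inner_prod_commute[of C "\<omega> k"] field_simps split: if_splits)

lemma inner_weight_word:
  assumes "k \<in> nodes C" "set us \<subseteq> nodes C" "k \<notin> set us"
  shows "inner_prod C (\<omega> k) (W us v) = inner_prod C (\<omega> k) v"
  using inner_prod_word[of us "\<omega> k" v] assms by (simp add: word_fixes_weight)

text \<open>The inner product below is, up to a positive factor, the coefficient of \<open>\<alpha> k\<close> in
  \<open>\<omega> j - c (\<omega> j)\<close>, so a Coxeter element \<open>c\<close> determines the relative order of adjacent nodes in
  all its full words.\<close>

lemma order_detected_by_weights:
  assumes "full_word (us @ j # vs)" "adjacent C k j"
  shows "inner_prod C (\<omega> k) (\<lambda>l. \<omega> j l - W (us @ j # vs) (\<omega> j) l) \<noteq> 0 \<longleftrightarrow> k \<in> set us"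
proof -
  have sub: "set us \<subseteq> nodes C" "j \<in> nodes C" "j \<notin> set us" "distinct us"
    "set (us @ j # vs) \<subseteq> nodes C" "j \<notin> set vs"
    using assms(1) by (auto simp: full_word_def)
  have k: "k \<in> nodes C" "k \<noteq> j" using assms(2) by (auto simp: adjacent_def)
  have "(\<lambda>l. \<omega> j l - W (us @ j # vs) (\<omega> j) l) = W us (\<alpha> j)"
    by (simp only: weight_minus_word[OF sub(5,3,6)]) simp
  moreover have "inner_prod C (\<omega> k) (W us (\<alpha> j)) = 0" if "k \<notin> set us"
    using that k sub by (simp add: inner_weight_word inner_weight_root)
  moreover have "inner_prod C (\<omega> k) (W us (\<alpha> j)) \<noteq> 0" if kus: "k \<in> set us"
  proof -
    obtain as bs where us: "us = as @ k # bs" using split_list[OF kus] by blast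
    have ab: "k \<notin> set as" "k \<notin> set bs" "set as \<subseteq> nodes C" "set bs \<subseteq> nodes C" "distinct bs"
      using sub us by auto
    let ?v = "W bs (\<alpha> j)"
    \<comment> \<open>Adjacency makes the pairing strictly negative, and the letters in
      \<open>bs\<close> can only lower it. So \<open>s k\<close> creates a nonzero coefficient of
      \<open>\<alpha> k\<close>, which the letters in \<open>as\<close> leave alone.\<close>
    have "coroot_pairing C k (\<alpha> j) < 0"
      using assms(2) k sub pairing_root_nonpos[of k j] by (auto simp: adjacent_def)
    then have neg: "coroot_pairing C k ?v < 0"
      using pairing_word_root_le[of bs j k] k sub us ab by auto
    have "inner_prod C (\<omega> k) (W us (\<alpha> j)) = inner_prod C (\<omega> k) (s k ?v)"
      using k ab us by (simp add: inner_weight_word)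
    also have "\<dots> = inner_prod C (\<omega> k) ?v - coroot_pairing C k ?v * inner_prod C (\<omega> k) (\<alpha> k)"
      using inner_prod_lincomb[of C "\<omega> k" 1 ?v "- coroot_pairing C k ?v" "\<alpha> k"]
      by (simp add: simple_reflection_def)
    also have "\<dots> = - coroot_pairing C k ?v * (inner_prod C (\<alpha> k) (\<alpha> k) / 2)"
      using k ab sub by (simp add: inner_weight_word inner_weight_root)
    finally show ?thesis using neg root_norm_pos[of k] k by simp
  qed
  ultimately show ?thesis by auto
qed

section \<open>Adaptedness by fixed heights, and the Coxeter element of a quiver\<close>

definition compatible :: "(nat \<Rightarrow> int) \<Rightarrow> nat list \<Rightarrow> bool" where
  "compatible \<xi> ws \<longleftrightarrow> sorted_wrt (\<lambda>i j. adjacent C i j \<longrightarrow> \<xi> i > \<xi> j) ws"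

text \<open>Adaptedness updates the heights along the word, compatibility keeps the original ones.
  In a word without repetition the node just lowered does not occur again, so the comparisons of
  later letters are unaffected.\<close>

lemma adapted_imp_compatible:
  "adapted C \<xi> ws \<Longrightarrow> distinct ws \<Longrightarrow> compatible \<xi> ws"
proof (induction ws arbitrary: \<xi>)
  case (Cons i ws)
  then have "compatible (reflect_height i \<xi>) ws" by simp
  then have "compatible \<xi> ws"
    unfolding compatible_def
    by (rule sorted_wrt_mono_rel[rotated])
      (use Cons.prems in \<open>auto simp: reflect_height_def split: if_splits\<close>)
  then show ?case using Cons.prems by (auto simp: compatible_def is_source_def)
qed (simp add: compatible_def)

text \<open>Stated for suffixes so that the induction goes through: nodes outside the remaining word
  have already been lowered by 2, and the last hypothesis records that they lie below their
  remaining neighbours.\<close>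

lemma compatible_imp_adapted_suffix:
  assumes "dynkin_quiver C \<xi>" "distinct ws" "set ws \<subseteq> nodes C" "compatible \<xi> ws"
    and "\<And>i j. i \<in> set ws \<Longrightarrow> j \<notin> set ws \<Longrightarrow> adjacent C i j \<Longrightarrow> \<xi> i > \<xi> j"
  shows "adapted C \<xi> ws"
  using assms
proof (induction ws arbitrary: \<xi>)
  case (Cons i ws)
  let ?\<xi> = "reflect_height i \<xi>"
  have src: "\<xi> i > \<xi> j" if "adjacent C i j" for j
  proof (cases "j \<in> set ws")
    case True
    then show ?thesis using Cons.prems(4) that by (auto simp: compatible_def)
  next
    case False
    moreover have "j \<noteq> i" using that by (auto simp: adjacent_def)
    ultimately show ?thesis using Cons.prems(5)[of i j] that by simp
  qed
  \<comment> \<open>A source exceeds each neighbour by exactly 1, so lowering it by 2 puts it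
    exactly 1 below them: the result is again a height function.\<close>
  have diff: "\<xi> i = \<xi> j + 1" if "adjacent C i j" for j
    using src[OF that] Cons.prems(1) that by (force simp: dynkin_quiver_def)
  have "adapted C ?\<xi> ws"
  proof (rule Cons.IH)
    show "dynkin_quiver C ?\<xi>"
      unfolding dynkin_quiver_def
    proof (intro allI impI)
      fix a b assume ab: "adjacent C a b"
      then have "\<bar>\<xi> a - \<xi> b\<bar> = 1" "a \<noteq> b"
        using Cons.prems(1) by (auto simp: dynkin_quiver_def adjacent_def)
      then show "\<bar>?\<xi> a - ?\<xi> b\<bar> = 1"
        using diff[of a] diff[of b] ab adjacent_sym[of a b] by (auto simp: reflect_height_def)
    qed
    show "compatible ?\<xi> ws"
      using Cons.prems(2,4) unfolding compatible_def sorted_wrt.simps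
      by (auto elim!: sorted_wrt_mono_rel[rotated] simp: reflect_height_def split: if_splits)
    fix a b assume ab: "a \<in> set ws" "b \<notin> set ws" "adjacent C a b"
    show "?\<xi> a > ?\<xi> b"
      using ab Cons.prems(2) Cons.prems(5)[of a b] diff[of a] adjacent_sym[of a b]
      by (cases "b = i") (auto simp: reflect_height_def)
  qed (use Cons.prems in auto)
  then show ?case using src Cons.prems(3) by (simp add: is_source_def)
qed simp

lemma compatible_imp_adapted:
  assumes "dynkin_quiver C \<xi>" "full_word ws" "compatible \<xi> ws"
  shows "adapted C \<xi> ws"
  using assms by (intro compatible_imp_adapted_suffix) (auto simp: full_word_def adjacent_def)

text \<open>Compatibility concerns only the relative order of adjacent letters, and by
  \<open>order_detected_by_weights\<close> that order can be read off the element itself.\<close>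

lemma compatible_same_element:
  assumes "full_word ws" "full_word us" "W us = W ws" "compatible \<xi> ws"
  shows "compatible \<xi> us"
  unfolding compatible_def sorted_wrt_iff_nth_less
proof (intro allI impI)
  fix p q assume pq: "p < q" "q < length us" and adj: "adjacent C (us ! p) (us ! q)"
  let ?j = "us ! p" and ?k = "us ! q"
  have us: "us = take p us @ ?j # drop (Suc p) us" using pq by (simp add: id_take_nth_drop)
  have "?k \<notin> set (take p us)"
    using pq assms(2) by (auto simp: full_word_def in_set_conv_nth nth_eq_iff_index_eq)
  moreover have adj': "adjacent C ?k ?j" using adj adjacent_sym by blast
  ultimately have "inner_prod C (\<omega> ?k) (\<lambda>l. \<omega> ?j l - W us (\<omega> ?j) l) = 0"
    using order_detected_by_weights[of "take p us" ?j "drop (Suc p) us" ?k] assms(2) us by auto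
  moreover have "?j \<in> set ws" using assms(1,2) pq by (auto simp: full_word_def)
  then obtain as bs where ws: "ws = as @ ?j # bs" using split_list by metis
  ultimately have "?k \<notin> set as"
    using order_detected_by_weights[of as ?j bs ?k] assms(1,3) adj' by auto
  moreover have "?k \<in> set ws" "?k \<noteq> ?j" using assms(1) adj by (auto simp: full_word_def adjacent_def)
  ultimately have "?k \<in> set bs" using ws by (metis Un_iff set_ConsD set_append)
  then show "\<xi> ?j > \<xi> ?k" using assms(4) ws adj
    by (metis (no_types, lifting) compatible_def sorted_wrt.simps(2) sorted_wrt_append)
qed

lemma reflection_commute:
  assumes "i \<in> nodes C" "j \<in> nodes C" "\<not> adjacent C i j"
  shows "s i \<circ> s j = s j \<circ> s i"
proof (cases "i = j")
  case False
  then have "coroot_pairing C i (\<alpha> j) = 0" "coroot_pairing C j (\<alpha> i) = 0"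
    using assms adjacent_sym[of i j] by (auto simp: adjacent_def)
  then have "coroot_pairing C i (s j v) = coroot_pairing C i v"
    "coroot_pairing C j (s i v) = coroot_pairing C j v" for v
    using coroot_pairing_lincomb[of C i 1 v "- coroot_pairing C j v" "\<alpha> j"]
      coroot_pairing_lincomb[of C j 1 v "- coroot_pairing C i v" "\<alpha> i"]
    by (simp_all add: simple_reflection_def)
  then have "s i (s j v) k = s j (s i v) k" for v k
    by (simp add: simple_reflection_def[of C i "s j v"] simple_reflection_def[of C j "s i v"])
      (simp add: simple_reflection_def)
  then show ?thesis by (auto simp: fun_eq_iff)
qed simp

lemma reflection_commute_word:
  assumes "i \<in> nodes C" "set us \<subseteq> nodes C" "\<And>j. j \<in> set us \<Longrightarrow> \<not> adjacent C i j"
  shows "W us \<circ> s i = s i \<circ> W us"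
  using assms(2,3)
proof (induction us)
  case (Cons j us)
  then have "W us \<circ> s i = s i \<circ> W us" by (simp add: comp_def)
  then have "W (j # us) \<circ> s i = (s j \<circ> s i) \<circ> W us"
    unfolding word_element_Cons comp_assoc by (rule arg_cong)
  also have "\<dots> = s i \<circ> W (j # us)"
    using reflection_commute[of i j] assms(1) Cons.prems by (simp add: comp_def fun_eq_iff)
  finally show ?case .
qed simp

text \<open>The first letter of \<open>ws\<close> can be moved to the front of \<open>us\<close>: a
  letter preceding it there cannot be adjacent to it, since the two words would then compare the two
  heights in opposite ways.\<close>

lemma compatible_unique:
  assumes "distinct ws" "distinct us" "set ws = set us" "set us \<subseteq> nodes C"
    and "compatible \<xi> ws" "compatible \<xi> us"
  shows "W ws = W us"
  using assms
proof (induction ws arbitrary: us)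
  case (Cons i ws)
  then obtain as bs where us: "us = as @ i # bs" by (metis list.set_intros(1) split_list)
  have "\<not> adjacent C i j" if "j \<in> set as" for j
  proof
    assume adj: "adjacent C i j"
    have "j \<in> set ws" using Cons.prems that us by auto
    then have "\<xi> i > \<xi> j" using Cons.prems(5) adj by (auto simp: compatible_def)
    moreover have "\<xi> j > \<xi> i"
      using Cons.prems(6) adj that us adjacent_sym by (auto simp: compatible_def sorted_wrt_append)
    ultimately show False by simp
  qed
  then have comm: "W as \<circ> s i = s i \<circ> W as"
    using Cons.prems us by (intro reflection_commute_word) auto
  have "W ws = W (as @ bs)"
  proof (rule Cons.IH)
    show "set ws = set (as @ bs)" using Cons.prems(1,2,3) us by auto
  qed (use Cons.prems us in \<open>auto simp: compatible_def sorted_wrt_append\<close>)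
  then show ?case using comm us by (metis comp_assoc word_element_Cons word_element_append)
qed simp

text \<open>Resolves the definite description by one word. Reduced expressions of
  \<open>W ws\<close> are full words of the same element, hence compatible and adapted; conversely
  any candidate has an adapted full word, and compatible full words all give one element.\<close>

theorem quiver_coxeter_eq:
  assumes "dynkin_quiver C \<xi>" "full_word ws" "compatible \<xi> ws"
  shows "quiver_coxeter C \<xi> = W ws"
  unfolding quiver_coxeter_def
proof (rule the_equality)
  show "coxeter_element C (W ws) \<and>
    (\<forall>us. reduced_expression C us (W ws) \<longrightarrow> adapted C \<xi> us)"
    using assms compatible_same_element compatible_imp_adapted
    by (auto simp: coxeter_element_def reduced_expression_full_word full_word_def)
next
  fix t
  assume t: "coxeter_element C t \<and> (\<forall>us. reduced_expression C us t \<longrightarrow> adapted C \<xi> us)"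
  then obtain us where us: "full_word us" "t = W us"
    by (auto simp: coxeter_element_def full_word_def)
  then have "adapted C \<xi> us" using t reduced_expression_full_word by blast
  then have "compatible \<xi> us" using us by (auto simp: full_word_def intro: adapted_imp_compatible)
  then show "t = W ws"
    using compatible_unique[of us ws \<xi>] us assms by (auto simp: full_word_def)
qed

lemma gamma_root_eq:
  assumes "dynkin_quiver C \<xi>" "full_word (us @ j # vs)" "compatible \<xi> (us @ j # vs)"
  shows "gamma_root C \<xi> j = W us (\<alpha> j)"
proof -
  have "W (us @ j # vs) (\<omega> j) = (\<lambda>k. \<omega> j k - W us (\<alpha> j) k)"
    using assms(2) by (intro weight_minus_word) (auto simp: full_word_def)
  then show ?thesis unfolding gamma_root_def quiver_coxeter_eq[OF assms] by simp
qed

end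

section \<open>Inversions and the longest element\<close>

text \<open>The axioms are those properties of the positive roots that make word length equal to the
  number of inversions; for types B and D they can be checked in coordinates.\<close>

locale positive_system = dynkin_datum +
  fixes P :: "vec set"
  assumes finite_P: "finite P"
    and simple_in_P: "i \<in> nodes C \<Longrightarrow> simple_root C i \<in> P"
    and neg_notin_P: "\<beta> \<in> P \<Longrightarrow> (\<lambda>k. - \<beta> k) \<notin> P"
    and reflection_in_P: "i \<in> nodes C \<Longrightarrow> \<beta> \<in> P \<Longrightarrow> \<beta> \<noteq> simple_root C i \<Longrightarrow>
          simple_reflection C i \<beta> \<in> P"
begin

definition inversions :: "(vec \<Rightarrow> vec) \<Rightarrow> vec set" where
  "inversions w = {\<beta> \<in> P. (\<lambda>k. - w \<beta> k) \<in> P}"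

lemma finite_inversions: "finite (inversions w)"
  using finite_P by (simp add: inversions_def)

text \<open>The involution \<open>s i\<close> permutes \<open>P\<close> without
  \<open>\<alpha> i\<close>, which transports all other inversions. Since \<open>s i\<close> negates
  \<open>\<alpha> i\<close>, this root is an inversion of the product exactly when
  \<open>W ws\<close> keeps it positive.\<close>

lemma inversions_reflection:
  assumes "set ws \<subseteq> nodes C" "i \<in> nodes C"
  shows "inversions (W ws \<circ> s i) = s i ` (inversions (W ws) - {\<alpha> i}) \<union>
    (if W ws (\<alpha> i) \<in> P then {\<alpha> i} else {})"
proof (rule set_eqI)
  fix \<beta>
  have sinv: "s i (s i v) = v" for v by (rule simple_reflection_involutive[OF assms(2)])
  have img: "\<beta> \<in> s i ` A \<longleftrightarrow> s i \<beta> \<in> A" for A using sinv by (metis image_iff)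
  have root: "W ws (s i (\<alpha> i)) = (\<lambda>k. - W ws (\<alpha> i) k)"
    using assms(2) by (simp add: simple_reflection_root word_element_uminus)
  have sroot: "s i (\<alpha> i) = (\<lambda>k. - \<alpha> i k)" using assms(2) by (rule simple_reflection_root)
  show "\<beta> \<in> inversions (W ws \<circ> s i) \<longleftrightarrow>
    \<beta> \<in> s i ` (inversions (W ws) - {\<alpha> i}) \<union> (if W ws (\<alpha> i) \<in> P then {\<alpha> i} else {})"
  proof (cases "\<beta> = \<alpha> i")
    case True
    have "(\<lambda>k. - \<alpha> i k) \<notin> P" using neg_notin_P simple_in_P assms(2) by blast
    then show ?thesis
      using True simple_in_P[OF assms(2)] root sroot unfolding Un_iff img by (auto simp: inversions_def)
  next
    case False
    have ne: "\<beta> \<in> P \<Longrightarrow> s i \<beta> \<noteq> \<alpha> i"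
    proof
      assume "\<beta> \<in> P" "s i \<beta> = \<alpha> i"
      then have "\<beta> = (\<lambda>k. - \<alpha> i k)" using sinv[of \<beta>] sroot by simp
      then show False using \<open>\<beta> \<in> P\<close> neg_notin_P simple_in_P assms(2) by blast
    qed
    have "\<beta> \<in> P \<longleftrightarrow> s i \<beta> \<in> P \<and> s i \<beta> \<noteq> \<alpha> i"
      using False reflection_in_P[OF assms(2)] ne sinv by metis
    then show ?thesis using False unfolding Un_iff img by (auto simp: inversions_def)
  qed
qed

lemma inj_reflection: "i \<in> nodes C \<Longrightarrow> inj_on (s i) A"
  by (metis inj_onI simple_reflection_involutive)

lemma card_inversions_up:
  assumes "set ws \<subseteq> nodes C" "i \<in> nodes C" "W ws (\<alpha> i) \<in> P"
  shows "card (inversions (W ws \<circ> s i)) = Suc (card (inversions (W ws)))"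
proof -
  have "\<alpha> i \<notin> inversions (W ws)" using assms(3) neg_notin_P by (auto simp: inversions_def)
  moreover have "\<alpha> i \<notin> s i ` inversions (W ws)"
  proof
    assume "\<alpha> i \<in> s i ` inversions (W ws)"
    then obtain \<beta> where "\<beta> \<in> P" "\<alpha> i = s i \<beta>" by (auto simp: inversions_def)
    then have "\<beta> = (\<lambda>k. - \<alpha> i k)"
      using simple_reflection_involutive[OF assms(2)] simple_reflection_root[OF assms(2)] by metis
    then show False using \<open>\<beta> \<in> P\<close> neg_notin_P simple_in_P assms(2) by blast
  qed
  ultimately show ?thesis
    using assms finite_inversions card_image[OF inj_reflection[OF assms(2)]]
    by (simp add: inversions_reflection)
qed

lemma card_inversions_down:
  assumes "set ws \<subseteq> nodes C" "i \<in> nodes C" "W ws (\<alpha> i) \<notin> P"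
  shows "card (inversions (W ws \<circ> s i)) \<le> card (inversions (W ws))"
  using assms finite_inversions card_image[OF inj_reflection[OF assms(2)]]
  by (simp add: inversions_reflection card_Diff1_le)

lemma card_inversions_le_length:
  "set ws \<subseteq> nodes C \<Longrightarrow> card (inversions (W ws)) \<le> length ws"
proof (induction ws rule: rev_induct)
  case Nil
  have "inversions (W []) = {}" using neg_notin_P by (auto simp: inversions_def)
  then show ?case by (metis card.empty le0)
next
  case (snoc i ws)
  then show ?case
    unfolding word_element_snoc
    using card_inversions_up[of ws i] card_inversions_down[of ws i]
    by (cases "W ws (\<alpha> i) \<in> P") (auto simp: comp_def)
qed

text \<open>Each letter raises the number of inversions by at most 1, and only if the root it
  produces is positive. If the count reaches the length, every letter must have raised it.\<close>

lemma prefix_root_positive: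
  assumes "set (us @ i # vs) \<subseteq> nodes C"
    and "card (inversions (W (us @ i # vs))) = length (us @ i # vs)"
  shows "W us (\<alpha> i) \<in> P"
  using assms
proof (induction vs rule: rev_induct)
  case Nil
  then have "set us \<subseteq> nodes C" "i \<in> nodes C" "card (inversions (W us \<circ> s i)) = Suc (length us)"
    unfolding word_element_snoc by (simp_all add: comp_def)
  then show ?case
    using card_inversions_le_length[of us] card_inversions_down[of us i] by fastforce
next
  case (snoc j vs)
  let ?ws = "us @ i # vs"
  have eq: "us @ i # vs @ [j] = ?ws @ [j]" by simp
  have sub: "set ?ws \<subseteq> nodes C" "j \<in> nodes C" using snoc.prems by auto
  have "card (inversions (W ?ws \<circ> s j)) = Suc (length ?ws)"
    using snoc.prems(2) unfolding eq word_element_append by (simp add: comp_def)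
  then have "card (inversions (W ?ws)) = length ?ws"
    using card_inversions_up[OF sub] card_inversions_down[OF sub] card_inversions_le_length[OF sub(1)]
    by (cases "W ?ws (\<alpha> j) \<in> P") auto
  then show ?case by (intro snoc.IH sub)
qed

section \<open>Exchange condition and longest element\<close>

lemma word_conjugates_reflection:
  assumes "set us \<subseteq> nodes C" "W us (\<alpha> j) = \<alpha> i"
  shows "W us \<circ> s j = s i \<circ> W us"
proof
  fix v
  have "coroot_pairing C i (W us v) = coroot_pairing C j v"
    unfolding coroot_pairing_def assms(2)[symmetric] by (simp add: inner_prod_word[OF assms(1)])
  moreover have "W us (s j v) = (\<lambda>k. W us v k - coroot_pairing C j v * W us (\<alpha> j) k)"
    using word_element_lincomb[of C us 1 v "- coroot_pairing C j v" "\<alpha> j"]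
    by (simp add: simple_reflection_def)
  ultimately show "(W us \<circ> s j) v = (s i \<circ> W us) v"
    by (simp add: assms(2) simple_reflection_def)
qed

text \<open>Apply the letters to \<open>\<alpha> j\<close> from right to left. Just before the
  letter \<open>i\<close> that takes the root out of \<open>P\<close>, the root must be
  \<open>\<alpha> i\<close>; then \<open>s j\<close> is conjugate to that \<open>s i\<close> and the
  two cancel.\<close>

lemma exchange:
  assumes "set ws \<subseteq> nodes C" "j \<in> nodes C" "W ws (\<alpha> j) \<notin> P"
  shows "\<exists>us. set us \<subseteq> nodes C \<and> length us < length ws \<and> W (ws @ [j]) = W us"
  using assms
proof (induction ws)
  case Nil
  then show ?case using simple_in_P by simp
next
  case (Cons i ws)
  have i: "i \<in> nodes C" "set ws \<subseteq> nodes C" using Cons.prems by auto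
  show ?case
  proof (cases "W ws (\<alpha> j) \<in> P")
    case True
    then have "W ws (\<alpha> j) = \<alpha> i" using Cons.prems reflection_in_P[OF i(1)] by auto
    then have "W ws \<circ> s j = s i \<circ> W ws" using i by (intro word_conjugates_reflection)
    then have "W ((i # ws) @ [j]) = W ws"
      using i(1) by (simp add: comp_assoc) (simp add: fun_eq_iff simple_reflection_involutive)
    then show ?thesis using i(2) by (intro exI[of _ ws]) simp
  next
    case False
    then obtain us where "set us \<subseteq> nodes C" "length us < length ws" "W (ws @ [j]) = W us"
      using Cons i by blast
    then show ?thesis using i by (intro exI[of _ "i # us"]) (simp add: comp_assoc)
  qed
qed

text \<open>Prefixes of a shortest word are shortest, and its last letter must produce a positive
  root, as otherwise \<open>exchange\<close> would shorten the word.\<close>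

lemma card_inversions_minimal_word:
  assumes "set ws \<subseteq> nodes C"
    and "\<And>us. set us \<subseteq> nodes C \<Longrightarrow> W us = W ws \<Longrightarrow> length ws \<le> length us"
  shows "card (inversions (W ws)) = length ws"
  using assms
proof (induction ws rule: rev_induct)
  case Nil
  then show ?case using card_inversions_le_length[of "[]"] by (simp add: id_def)
next
  case (snoc j ws)
  have sub: "set ws \<subseteq> nodes C" "j \<in> nodes C" using snoc.prems(1) by auto
  have "length ws \<le> length us" if us: "set us \<subseteq> nodes C" "W us = W ws" for us
  proof -
    have "length (ws @ [j]) \<le> length (us @ [j])"
      by (rule snoc.prems(2)) (use us sub in auto)
    then show ?thesis by simp
  qed
  then have "card (inversions (W ws)) = length ws" using snoc.IH sub by blast
  moreover have "W ws (\<alpha> j) \<in> P"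
  proof (rule ccontr)
    assume "W ws (\<alpha> j) \<notin> P"
    then obtain us where "set us \<subseteq> nodes C" "length us < length ws" "W (ws @ [j]) = W us"
      using exchange sub by blast
    then show False using snoc.prems(2)[of us] by simp
  qed
  ultimately show ?case
    unfolding word_element_snoc using card_inversions_up[OF sub] by (simp add: comp_def)
qed

lemma minimal_word:
  assumes "w \<in> weyl_group C"
  obtains ws where "set ws \<subseteq> nodes C" "W ws = w" "length ws = weyl_length C w"
    "\<And>us. set us \<subseteq> nodes C \<Longrightarrow> W us = w \<Longrightarrow> length ws \<le> length us"
proof -
  let ?Q = "\<lambda>l. \<exists>ws\<in>lists (nodes C). length ws = l \<and> W ws = w"
  obtain us where "us \<in> lists (nodes C)" "W us = w" using assms by (auto simp: weyl_group_def)
  then have "?Q (length us)" by blast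
  then have "?Q (weyl_length C w)" unfolding weyl_length_def by (rule LeastI)
  moreover have "weyl_length C w \<le> length us" if "set us \<subseteq> nodes C" "W us = w" for us
    unfolding weyl_length_def by (rule Least_le) (use that in blast)
  ultimately show ?thesis using that by (metis in_listsD subsetI)
qed

lemma weyl_length_eq: "w \<in> weyl_group C \<Longrightarrow> weyl_length C w = card (inversions w)"
  by (metis card_inversions_minimal_word minimal_word)

lemma no_inversions_imp_id:
  assumes "w \<in> weyl_group C" "inversions w = {}" shows "w = id"
  using minimal_word[OF assms(1)] weyl_length_eq[OF assms(1)] assms(2)
  by (metis card.empty length_0_conv word_element_Nil)

text \<open>Inverting all of \<open>P\<close> gives the maximal length. An element of the same
  length also inverts all of \<open>P\<close>, so its product with \<open>w\<close> has no
  inversions and is the identity.\<close>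

theorem longest_element_eq:
  assumes w: "w \<in> weyl_group C" and neg: "\<And>\<beta>. \<beta> \<in> P \<Longrightarrow> (\<lambda>k. - w \<beta> k) \<in> P"
  shows "longest_element C = w"
proof -
  have inv_w: "inversions w = P" using neg by (auto simp: inversions_def)
  have le: "weyl_length C v \<le> weyl_length C w" if "v \<in> weyl_group C" for v
  proof -
    have "card (inversions v) \<le> card P"
      using finite_P by (intro card_mono) (auto simp: inversions_def)
    then show ?thesis using that w inv_w by (simp add: weyl_length_eq)
  qed
  obtain ws where ws: "set ws \<subseteq> nodes C" "w = W ws" using minimal_word[OF w] by metis
  have comp_id: "w \<circ> v = id" if v: "v \<in> weyl_group C" "inversions v = P" for v
  proof (rule no_inversions_imp_id)
    obtain vs where vs: "set vs \<subseteq> nodes C" "v = W vs" using minimal_word[OF v(1)] by metis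
    have "w \<circ> v = W (ws @ vs)" using ws vs by simp
    moreover have "ws @ vs \<in> lists (nodes C)" using ws(1) vs(1) by auto
    ultimately show "w \<circ> v \<in> weyl_group C" unfolding weyl_group_def by blast
    have "w (v \<beta>) \<in> P" if "\<beta> \<in> P" for \<beta>
    proof -
      have "(\<lambda>k. - v \<beta> k) \<in> P" using that v(2) by (auto simp: inversions_def)
      then have "(\<lambda>k. - w (\<lambda>k. - v \<beta> k) k) \<in> P" by (rule neg)
      then show ?thesis using ws(2) by (simp add: word_element_uminus)
    qed
    then show "inversions (w \<circ> v) = {}" using neg_notin_P by (fastforce simp: inversions_def)
  qed
  show ?thesis
    unfolding longest_element_def
  proof (rule the_equality)
    show "w \<in> weyl_group C \<and> (\<forall>v\<in>weyl_group C. weyl_length C v \<le> weyl_length C w)"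
      using w le by blast
  next
    fix v assume v: "v \<in> weyl_group C \<and> (\<forall>u\<in>weyl_group C. weyl_length C u \<le> weyl_length C v)"
    then have "weyl_length C v = weyl_length C w" using le w by (simp add: order_antisym)
    then have "card (inversions v) = card P" using v w inv_w by (simp add: weyl_length_eq)
    then have "inversions v = P"
      using finite_P by (intro card_subset_eq) (auto simp: inversions_def)
    \<comment> \<open>With \<open>v\<close> replaced by \<open>w\<close> the same argument shows
      that \<open>w\<close> is an involution, whence \<open>v\<close> equals
      \<open>w\<close>.\<close>
    then have "w \<circ> v = id" "w \<circ> w = id" using comp_id v w inv_w by blast+
    then show "v = w" by (metis comp_assoc comp_id id_comp)
  qed
qed

lemma involution_eq:
  assumes "i \<in> nodes C" "j \<in> nodes C" "longest_element C (\<alpha> i) = (\<lambda>k. - \<alpha> j k)"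
  shows "involution C i = j"
  unfolding involution_def
proof (rule the_equality)
  fix l assume "l \<in> nodes C \<and> longest_element C (\<alpha> i) = (\<lambda>k. - \<alpha> l k)"
  then have "l \<in> nodes C" "\<alpha> l = \<alpha> j" using assms(3) by (auto simp: fun_eq_iff)
  then show "l = j" using inj_simple_root assms(2) by (meson inj_onD)
qed (use assms in simp)

end

section \<open>Types B and D\<close>

lemma type_B_simps [simp]:
  "ambient_dim (type_B n) = n" "nodes (type_B n) = {1..n}"
  "simple_root (type_B n) i = (if i = n then eps n else root_pair i (-1) (i + 1))"
  by (simp_all add: type_B_def)

lemma type_D_simps [simp]:
  "ambient_dim (type_D_Suc n) = n + 1" "nodes (type_D_Suc n) = {1..n + 1}"
  "simple_root (type_D_Suc n) i =
    (if i = n + 1 then root_pair n 1 (n + 1) else root_pair i (-1) (i + 1))"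
  by (simp_all add: type_D_Suc_def)

lemma inner_prod_B:
  "i \<in> {1..n} \<Longrightarrow> inner_prod (type_B n) (simple_root (type_B n) i) v =
    (if i = n then v n else v i - v (i + 1))"
  by (auto simp: inner_prod_eps inner_prod_root_pair)

lemma inner_prod_D:
  "n \<ge> 1 \<Longrightarrow> i \<in> {1..n + 1} \<Longrightarrow> inner_prod (type_D_Suc n) (simple_root (type_D_Suc n) i) v =
    (if i = n + 1 then v n + v (n + 1) else v i - v (i + 1))"
  by (auto simp: inner_prod_root_pair)

lemma pairing_B:
  "i \<in> {1..n} \<Longrightarrow> coroot_pairing (type_B n) i v = (if i = n then 2 * v n else v i - v (i + 1))"
  unfolding coroot_pairing_def inner_prod_B by (simp add: eps_def root_pair_def)

lemma pairing_D:
  "n \<ge> 1 \<Longrightarrow> i \<in> {1..n + 1} \<Longrightarrow> coroot_pairing (type_D_Suc n) i v =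
    (if i = n + 1 then v n + v (n + 1) else v i - v (i + 1))"
  unfolding coroot_pairing_def inner_prod_D by (simp add: eps_def root_pair_def)

section \<open>Simple reflections as signed coordinate permutations\<close>

lemma reflection_B_swap:
  "1 \<le> i \<Longrightarrow> i < n \<Longrightarrow> simple_reflection (type_B n) i v = v(i := v (i + 1), i + 1 := v i)"
  by (auto simp: simple_reflection_def pairing_B root_pair_def eps_def)

lemma reflection_B_last:
  "1 \<le> n \<Longrightarrow> simple_reflection (type_B n) n v = v(n := - v n)"
  by (auto simp: simple_reflection_def pairing_B eps_def)

lemma reflection_D_swap:
  "1 \<le> i \<Longrightarrow> i \<le> n \<Longrightarrow> simple_reflection (type_D_Suc n) i v = v(i := v (i + 1), i + 1 := v i)"
  by (auto simp: simple_reflection_def pairing_D root_pair_def eps_def)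

lemma reflection_D_last:
  "1 \<le> n \<Longrightarrow> simple_reflection (type_D_Suc n) (n + 1) v = v(n := - v (n + 1), n + 1 := - v n)"
  by (auto simp: simple_reflection_def pairing_D root_pair_def eps_def)

lemma adjacent_B:
  "adjacent (type_B n) i j \<longleftrightarrow> i \<in> {1..n} \<and> j \<in> {1..n} \<and> (j = i + 1 \<or> i = j + 1)"
  unfolding adjacent_def
  by (cases "i \<in> {1..n}") (auto simp: pairing_B eps_def root_pair_def)

lemma adjacent_D:
  assumes "n \<ge> 2" "i \<le> n" "j \<le> n"
  shows "adjacent (type_D_Suc n) i j \<longleftrightarrow> adjacent (type_B n) i j"
  unfolding adjacent_B unfolding adjacent_def using assms
  by (cases "i \<in> {1..n}") (auto simp: pairing_D eps_def root_pair_def)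

text \<open>The positive roots of type D of rank \<open>N\<close>, and at the same time the long
  positive roots of type B of rank \<open>N\<close>.\<close>

definition root_pairs :: "nat \<Rightarrow> vec set" where
  "root_pairs N = {root_pair a \<sigma> b | a \<sigma> b. 1 \<le> a \<and> a < b \<and> b \<le> N \<and> \<sigma> \<in> {1, -1}}"

definition positive_roots_B :: "nat \<Rightarrow> vec set" where
  "positive_roots_B n = root_pairs n \<union> eps ` {1..n}"

lemma root_pairsI:
  "1 \<le> a \<Longrightarrow> a < b \<Longrightarrow> b \<le> N \<Longrightarrow> \<sigma> \<in> {1, -1} \<Longrightarrow> root_pair a \<sigma> b \<in> root_pairs N"
  by (auto simp: root_pairs_def)

lemma finite_root_pairs: "finite (root_pairs N)"
proof (rule finite_subset)
  show "root_pairs N \<subseteq> (\<lambda>(a, \<sigma>, b). root_pair a \<sigma> b) ` ({1..N} \<times> {1, -1} \<times> {1..N})"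
    unfolding root_pairs_def by (force simp: image_iff)
qed simp

text \<open>Transposing \<open>i\<close> and \<open>i + 1\<close> reverses the order of the two
  indices only for the pair \<open>(i, i + 1)\<close>. With sign 1 that root is symmetric and stays
  fixed; sign -1 is the excluded simple root.\<close>

lemma swap_root_pair:
  assumes "v \<in> root_pairs N" "1 \<le> i" "i + 1 \<le> N" "v \<noteq> root_pair i (-1) (i + 1)"
  shows "v(i := v (i + 1), i + 1 := v i) \<in> root_pairs N"
proof -
  obtain a \<sigma> b where v: "v = root_pair a \<sigma> b" "1 \<le> a" "a < b" "b \<le> N" "\<sigma> \<in> {1, -1}"
    using assms(1) by (auto simp: root_pairs_def)
  define \<pi> where "\<pi> x = (if x = i then i + 1 else if x = i + 1 then i else x)" for x
  have swap: "v(i := v (i + 1), i + 1 := v i) = root_pair (\<pi> a) \<sigma> (\<pi> b)"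
    by (rule ext) (auto simp: v(1) \<pi>_def root_pair_def eps_def)
  show ?thesis
  proof (cases "a = i \<and> b = i + 1")
    case True
    then have "\<sigma> = 1" using v assms(4) by auto
    then have "root_pair (\<pi> a) \<sigma> (\<pi> b) = v"
      using True v(1) by (auto simp: \<pi>_def root_pair_def)
    then show ?thesis using swap assms(1) by simp
  next
    case False
    then show ?thesis
      unfolding swap using v assms(2,3) by (intro root_pairsI) (auto simp: \<pi>_def)
  qed
qed

text \<open>Positivity is lexicographic: the first nonzero coordinate is 1. Hence no vector is
  positive together with its negative.\<close>

lemma leading_coefficient:
  assumes "v \<in> root_pairs N \<union> eps ` {1..N}"
  shows "\<exists>a. v a = 1 \<and> (\<forall>k<a. v k = 0)"
proof -
  from assms consider a \<sigma> b where "v = root_pair a \<sigma> b" "a < b" | a where "v = eps a"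
    by (auto simp: root_pairs_def)
  then show ?thesis
  proof cases
    case (1 a \<sigma> b)
    then show ?thesis by (intro exI[of _ a]) (auto simp: root_pair_def eps_def)
  next
    case (2 a)
    then show ?thesis by (intro exI[of _ a]) (auto simp: eps_def)
  qed
qed

lemma uminus_root_not_positive:
  assumes "v \<in> root_pairs N \<union> eps ` {1..N}"
  shows "(\<lambda>k. - v k) \<notin> root_pairs N \<union> eps ` {1..N}"
proof
  assume "(\<lambda>k. - v k) \<in> root_pairs N \<union> eps ` {1..N}"
  then obtain a b where ab: "v a = 1" "\<forall>k<a. v k = 0" "- v b = 1" "\<forall>k<b. - v k = 0"
    using leading_coefficient[OF assms] leading_coefficient by blast
  then show False by (cases a b rule: linorder_cases) auto
qed

section \<open>Verification of the axioms in types B and D\<close>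

lemma dynkin_datum_B:
  assumes "n \<ge> 1" shows "dynkin_datum (type_B n)"
proof
  show "finite (nodes (type_B n))" by simp
  fix i assume i: "i \<in> nodes (type_B n)"
  show "supported (type_B n) (simple_root (type_B n) i)"
    using i by (auto simp: supported_def root_pair_def eps_def)
  show "inner_prod (type_B n) (simple_root (type_B n) i) (simple_root (type_B n) i) > 0"
    using i by (subst inner_prod_B) (auto simp: root_pair_def eps_def)
  \<comment> \<open>The witness is the fundamental weight \<open>eps 1 + ... + eps i\<close>, halved
    for \<open>i = n\<close> (the spin weight) because the coroot of the short root
    \<open>eps n\<close> is \<open>2 * eps n\<close>.\<close>
  show "\<exists>v. supported (type_B n) v \<and>
    (\<forall>j\<in>nodes (type_B n). coroot_pairing (type_B n) j v = (if j = i then 1 else 0))"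
    using i by (intro exI[of _ "\<lambda>k. if k \<in> {1..n} \<and> k \<le> i then (if i = n then 1/2 else 1) else 0"])
      (auto simp: supported_def pairing_B)
next
  fix i j assume "i \<in> nodes (type_B n)" "j \<in> nodes (type_B n)" "i \<noteq> j"
  then show "inner_prod (type_B n) (simple_root (type_B n) i) (simple_root (type_B n) j) \<le> 0"
    by (subst inner_prod_B) (auto simp: root_pair_def eps_def)
next
  have root: "simple_root (type_B n) i \<in> root_span (type_B n)" if "i \<in> {1..n}" for i
    using that by (intro simple_root_in_span) auto
  fix a assume "a \<in> {1..ambient_dim (type_B n)}"
  then have "a \<le> n" "1 \<le> a" by auto
  then show "eps a \<in> root_span (type_B n)"
  proof (induction a rule: inc_induct)
    case base
    then show ?case using root[of n] assms by simp
  next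
    case (step a)
    have "eps a = (\<lambda>k. 1 * simple_root (type_B n) a k + 1 * eps (Suc a) k)"
      using step by (auto simp: root_pair_def)
    then show ?case using root_span_lincomb[OF root step.IH, of a 1 1] step by simp
  qed
qed

lemma dynkin_datum_D:
  assumes "n \<ge> 2" shows "dynkin_datum (type_D_Suc n)"
proof
  show "finite (nodes (type_D_Suc n))" by simp
  fix i assume i: "i \<in> nodes (type_D_Suc n)"
  show "supported (type_D_Suc n) (simple_root (type_D_Suc n) i)"
    using i assms by (auto simp: supported_def root_pair_def eps_def)
  show "inner_prod (type_D_Suc n) (simple_root (type_D_Suc n) i) (simple_root (type_D_Suc n) i) > 0"
    using i assms by (subst inner_prod_D) (auto simp: root_pair_def eps_def)
  show "\<exists>v. supported (type_D_Suc n) v \<and>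
    (\<forall>j\<in>nodes (type_D_Suc n). coroot_pairing (type_D_Suc n) j v = (if j = i then 1 else 0))"
  proof (cases "i < n")
    case True
    then show ?thesis
      using i assms by (intro exI[of _ "\<lambda>k. if 1 \<le> k \<and> k \<le> i then 1 else 0"])
        (auto simp: supported_def pairing_D)
  next
    case False
    then have "i = n \<or> i = n + 1" using i by auto
    \<comment> \<open>The two half-spin weights, which differ in the sign of the last
      coordinate.\<close>
    then show ?thesis
      using assms
      by (intro exI[of _ "\<lambda>k. if 1 \<le> k \<and> k \<le> n then 1/2
            else if k = n + 1 then (if i = n then -1/2 else 1/2) else 0"])
        (auto simp: supported_def pairing_D)
  qed
next
  fix i j assume "i \<in> nodes (type_D_Suc n)" "j \<in> nodes (type_D_Suc n)" "i \<noteq> j"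
  then show "inner_prod (type_D_Suc n) (simple_root (type_D_Suc n) i) (simple_root (type_D_Suc n) j) \<le> 0"
    using assms by (subst inner_prod_D) (auto simp: root_pair_def eps_def)
next
  have root: "simple_root (type_D_Suc n) i \<in> root_span (type_D_Suc n)" if "i \<in> {1..n + 1}" for i
    using that by (intro simple_root_in_span) auto
  fix a assume "a \<in> {1..ambient_dim (type_D_Suc n)}"
  then have "a \<le> n \<or> a = n + 1" "1 \<le> a" by auto
  moreover have "eps a \<in> root_span (type_D_Suc n)" if "a \<le> n" "1 \<le> a" for a
    using that
  proof (induction a rule: inc_induct)
    case base
    have "eps n = (\<lambda>k. 1/2 * simple_root (type_D_Suc n) n k + 1/2 * simple_root (type_D_Suc n) (n + 1) k)"
      by (auto simp: root_pair_def field_simps)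
    then show ?case using root_span_lincomb[OF root root, of n "n + 1" "1/2" "1/2"] assms by simp
  next
    case (step a)
    have "eps a = (\<lambda>k. 1 * simple_root (type_D_Suc n) a k + 1 * eps (Suc a) k)"
      using step by (auto simp: root_pair_def)
    then show ?case using root_span_lincomb[OF root step.IH, of a 1 1] step by simp
  qed
  moreover have "eps (n + 1) \<in> root_span (type_D_Suc n)"
  proof -
    have "eps (n + 1) =
      (\<lambda>k. -1/2 * simple_root (type_D_Suc n) n k + 1/2 * simple_root (type_D_Suc n) (n + 1) k)"
      by (auto simp: root_pair_def field_simps)
    then show ?thesis using root_span_lincomb[OF root root, of n "n + 1" "-1/2" "1/2"] assms by simp
  qed
  ultimately show "eps a \<in> root_span (type_D_Suc n)" by auto
qed

lemma positive_system_B: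
  assumes "n \<ge> 1" shows "positive_system (type_B n) (positive_roots_B n)"
proof -
  interpret dynkin_datum "type_B n" using assms by (rule dynkin_datum_B)
  show ?thesis
  proof
    show "finite (positive_roots_B n)" by (simp add: positive_roots_B_def finite_root_pairs)
    fix i assume i: "i \<in> nodes (type_B n)"
    show "simple_root (type_B n) i \<in> positive_roots_B n"
      using i by (auto simp: positive_roots_B_def intro: root_pairsI)
  next
    fix \<beta> assume "\<beta> \<in> positive_roots_B n"
    then show "(\<lambda>k. - \<beta> k) \<notin> positive_roots_B n"
      using uminus_root_not_positive unfolding positive_roots_B_def by blast
  next
    fix i \<beta>
    assume i: "i \<in> nodes (type_B n)" and \<beta>: "\<beta> \<in> positive_roots_B n" "\<beta> \<noteq> simple_root (type_B n) i"
    show "simple_reflection (type_B n) i \<beta> \<in> positive_roots_B n"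
    proof (cases "i = n")
      case True
      from \<beta>(1) consider a \<sigma> b where "\<beta> = root_pair a \<sigma> b" "1 \<le> a" "a < b" "b \<le> n" "\<sigma> \<in> {1, -1}"
        | a where "\<beta> = eps a" "a \<in> {1..n}"
        by (auto simp: positive_roots_B_def root_pairs_def)
      then show ?thesis
      proof cases
        case (1 a \<sigma> b)
        have "\<beta>(n := - \<beta> n) = root_pair a (if b = n then -\<sigma> else \<sigma>) b"
          using 1 by (auto simp: root_pair_def eps_def)
        then have "\<beta>(n := - \<beta> n) \<in> root_pairs n" using 1 by (auto intro!: root_pairsI)
        then show ?thesis using True assms by (simp add: reflection_B_last positive_roots_B_def)
      next
        case (2 a)
        then have "a \<noteq> n" using \<beta>(2) True by auto
        then have "\<beta>(n := - \<beta> n) = \<beta>" using 2 by (auto simp: eps_def)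
        then show ?thesis using True assms \<beta>(1) by (simp add: reflection_B_last)
      qed
    next
      case False
      then have i': "1 \<le> i" "i < n" using i by auto
      show ?thesis
      proof (cases "\<beta> \<in> root_pairs n")
        case True
        then show ?thesis
          using swap_root_pair[of \<beta> n i] i' \<beta>(2) by (simp add: reflection_B_swap positive_roots_B_def)
      next
        case False
        then obtain a where a: "\<beta> = eps a" "a \<in> {1..n}" using \<beta>(1) by (auto simp: positive_roots_B_def)
        define b where "b = (if a = i then i + 1 else if a = i + 1 then i else a)"
        have "\<beta>(i := \<beta> (i + 1), i + 1 := \<beta> i) = eps b"
          by (rule ext) (auto simp: a(1) b_def eps_def)
        moreover have "b \<in> {1..n}" using a(2) i' by (auto simp: b_def)
        ultimately show ?thesis using i' by (auto simp: reflection_B_swap positive_roots_B_def)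
      qed
    qed
  qed
qed

lemma positive_system_D:
  assumes "n \<ge> 2" shows "positive_system (type_D_Suc n) (root_pairs (n + 1))"
proof -
  interpret dynkin_datum "type_D_Suc n" using assms by (rule dynkin_datum_D)
  show ?thesis
  proof
    show "finite (root_pairs (n + 1))" by (rule finite_root_pairs)
    fix i assume i: "i \<in> nodes (type_D_Suc n)"
    show "simple_root (type_D_Suc n) i \<in> root_pairs (n + 1)"
      using i assms by (auto intro!: root_pairsI)
  next
    fix \<beta> assume "\<beta> \<in> root_pairs (n + 1)"
    then show "(\<lambda>k. - \<beta> k) \<notin> root_pairs (n + 1)" using uminus_root_not_positive by blast
  next
    fix i \<beta>
    assume i: "i \<in> nodes (type_D_Suc n)"
      and \<beta>: "\<beta> \<in> root_pairs (n + 1)" "\<beta> \<noteq> simple_root (type_D_Suc n) i"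
    show "simple_reflection (type_D_Suc n) i \<beta> \<in> root_pairs (n + 1)"
    proof (cases "i = n + 1")
      case True
      obtain a \<sigma> b where v: "\<beta> = root_pair a \<sigma> b" "1 \<le> a" "a < b" "b \<le> n + 1" "\<sigma> \<in> {1, -1}"
        using \<beta>(1) by (auto simp: root_pairs_def)
      let ?\<gamma> = "\<beta>(n := - \<beta> (n + 1), n + 1 := - \<beta> n)"
      have "?\<gamma> \<in> root_pairs (n + 1)"
      proof (cases "a = n")
        case True
        then have b: "b = n + 1" using v by simp
        then have "\<beta> \<noteq> root_pair a 1 b" using \<beta>(2) True \<open>i = n + 1\<close> by simp
        then have "\<sigma> = -1" using v(1,5) by auto
        then have "?\<gamma> = \<beta>" using v(1) True b by (auto simp: root_pair_def eps_def)
        then show ?thesis using \<beta>(1) by simp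
      next
        case False
        define c where "c = (if b = n then n + 1 else if b = n + 1 then n else b)"
        have "?\<gamma> = root_pair a (if b < n then \<sigma> else - \<sigma>) c"
          using v False by (auto simp: c_def root_pair_def eps_def)
        moreover have "a < c" "c \<le> n + 1" using v False by (auto simp: c_def)
        ultimately show ?thesis using v by (auto intro!: root_pairsI)
      qed
      then show ?thesis using True assms reflection_D_last[of n \<beta>] by simp
    next
      case False
      then have "1 \<le> i" "i \<le> n" using i by auto
      then show ?thesis
        using swap_root_pair[of \<beta> "n + 1" i] \<beta> by (simp add: reflection_D_swap)
    qed
  qed
qed

text \<open>Index pairs inject into the positive roots: above the diagonal they give sums, on it the
  short roots, below it differences. The opposite inequality will come from the length of a word
  that inverts all of them.\<close>

lemma card_positive_roots_B: "n * n \<le> card (positive_roots_B n)"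
proof -
  define f :: "nat \<times> nat \<Rightarrow> vec" where
    "f = (\<lambda>(a, b) k. if k = b then 1 else if k = a then (if a < b then 1 else -1) else 0)"
  have supp: "{k. f (a, b) k \<noteq> 0} = {a, b}" for a b by (auto simp: f_def)
  have "inj_on f ({1..n} \<times> {1..n})"
  proof (rule inj_onI, clarify)
    fix a b c d assume eq: "f (a, b) = f (c, d)"
    \<comment> \<open>The support determines the unordered pair; transposed pairs are then told
      apart by the sign at the smaller index's root, a sum against a difference.\<close>
    then have "{a, b} = {c, d}" using supp by metis
    moreover have False if "a = d" "b = c" "a \<noteq> b"
      using fun_cong[OF eq, of a] fun_cong[OF eq, of b] that
      by (simp add: f_def split: if_splits)
    ultimately show "a = c \<and> b = d" by (auto simp: doubleton_eq_iff)
  qed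
  moreover have "f (a, b) \<in> positive_roots_B n" if "a \<in> {1..n}" "b \<in> {1..n}" for a b
  proof (cases a b rule: linorder_cases)
    case less
    then have "f (a, b) = root_pair a 1 b" by (auto simp: f_def root_pair_def eps_def)
    then show ?thesis using that less by (auto simp: positive_roots_B_def intro: root_pairsI)
  next
    case equal
    then have "f (a, b) = eps a" by (auto simp: f_def eps_def)
    then show ?thesis using that by (simp add: positive_roots_B_def)
  next
    case greater
    then have "f (a, b) = root_pair b (-1) a" by (auto simp: f_def root_pair_def eps_def)
    then show ?thesis using that greater by (auto simp: positive_roots_B_def intro: root_pairsI)
  qed
  then have "f ` ({1..n} \<times> {1..n}) \<subseteq> positive_roots_B n" by blast
  moreover have "finite (positive_roots_B n)" by (simp add: positive_roots_B_def finite_root_pairs)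
  ultimately have "card ({1..n} \<times> {1..n}) \<le> card (positive_roots_B n)" by (rule card_inj_on_le)
  then show ?thesis by simp
qed

section \<open>Coxeter elements of type B are negacyclic\<close>

lemma word_B_outside:
  assumes "set ws \<subseteq> {m..n}" "1 \<le> m" "k < m \<or> n < k"
  shows "word_element (type_B n) ws v k = v k"
  using assms(1)
proof (induction ws)
  case (Cons i ws)
  then have "simple_reflection (type_B n) i u k = u k" for u
    using assms(2,3) by (cases "i = n") (auto simp: reflection_B_last reflection_B_swap)
  then show ?case using Cons by simp
qed simp

lemma word_B_eps_below:
  assumes "set ws \<subseteq> {m..n}" "1 \<le> m" "k < m"
  shows "word_element (type_B n) ws (eps k) = eps k"
  using assms(1)
proof (induction ws)
  case (Cons i ws)
  then have "simple_reflection (type_B n) i (eps k) = eps k"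
    using assms(2,3) by (cases "i = n") (auto simp: reflection_B_last reflection_B_swap eps_def)
  then show ?case using Cons by simp
qed simp

text \<open>Coordinate \<open>n + 1\<close> is foreign to type B and is carried along untouched.
  This allows vectors of type D to be fed into words of type B.\<close>

lemma word_B_upd:
  assumes "set ws \<subseteq> {1..n}"
  shows "word_element (type_B n) ws (v(n + 1 := x)) = (word_element (type_B n) ws v)(n + 1 := x)"
  using assms
proof (induction ws)
  case (Cons i ws)
  have "simple_reflection (type_B n) i (u(n + 1 := x)) = (simple_reflection (type_B n) i u)(n + 1 := x)" for u
    using Cons.prems by (cases "i = n") (auto simp: reflection_B_last reflection_B_swap)
  then show ?case using Cons by (simp add: fun_upd_def)
qed simp

text \<open>\<open>c\<close> runs through the vectors \<open>eps a\<close> up to sign, for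
  \<open>a\<close> from \<open>m\<close> to \<open>m + L - 1\<close>, in one cycle: after
  \<open>L\<close> steps \<open>eps m\<close> is negated, before that coordinate \<open>m\<close>
  stays 0, and every index is visited within the first \<open>L\<close> steps.\<close>

definition negacyclic :: "(vec \<Rightarrow> vec) \<Rightarrow> nat \<Rightarrow> nat \<Rightarrow> bool" where
  "negacyclic c m L \<longleftrightarrow> (c ^^ L) (eps m) = (\<lambda>l. - eps m l) \<and>
     (\<forall>k. 0 < k \<and> k < L \<longrightarrow> (c ^^ k) (eps m) m = 0) \<and>
     (\<forall>a\<in>{m..<m + L}. \<exists>k<L. \<exists>\<sigma>. (c ^^ k) (eps m) = (\<lambda>l. \<sigma> * eps a l) \<and> \<sigma> \<in> {1, -1})"

text \<open>Peeling off the leftmost node: its reflection commutes with all but one of the others, so it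
  can be moved to one end of the word, where it lengthens the cycle by one.\<close>

lemma negacyclic_B:
  assumes "distinct ws" "set ws = {m..n}" "1 \<le> m" "m + L = Suc n" "0 < L"
  shows "negacyclic (word_element (type_B n) ws) m L"
  using assms
proof (induction L arbitrary: m ws)
  case (Suc L)
  let ?W = "word_element (type_B n)"
  interpret dynkin_datum "type_B n" using Suc.prems by (intro dynkin_datum_B) auto
  show ?case
  proof (cases "L = 0")
    case True
    then have m: "m = n" and "set ws = {n}" using Suc.prems by auto
    moreover have "length ws = 1" using Suc.prems(1) \<open>set ws = {n}\<close> distinct_card by fastforce
    ultimately have "ws = [n]" by (cases ws) auto
    then have "(?W ws ^^ 1) (eps n) = (\<lambda>l. - eps n l)"
      using Suc.prems m by (auto simp: reflection_B_last eps_def)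
    then show ?thesis using True m
      by (auto simp: negacyclic_def intro!: exI[of _ "1::real"])
  next
    case L_pos: False
    then have mn: "m < n" using Suc.prems by auto
    have "m \<in> set ws" using Suc.prems mn by auto
    then obtain us vs where ws: "ws = us @ m # vs" using split_list by metis
    define c where "c = ?W (us @ vs)"
    have "insert m (set (us @ vs)) = insert m {Suc m..n}"
      using Suc.prems(2) mn unfolding ws by (simp add: atLeastAtMost_insertL)
    moreover have "m \<notin> set (us @ vs)" using Suc.prems(1) unfolding ws by simp
    ultimately have zs: "set (us @ vs) = {Suc m..n}" "distinct (us @ vs)"
      using Suc.prems(1) insert_ident[of m "set (us @ vs)" "{Suc m..n}"] unfolding ws by auto
    have "negacyclic c (Suc m) L"
      unfolding c_def by (rule Suc.IH) (use zs Suc.prems L_pos in auto)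
    then have neg: "(c ^^ L) (eps (Suc m)) = (\<lambda>l. - eps (Suc m) l)"
      and zero: "\<And>k. 0 < k \<Longrightarrow> k < L \<Longrightarrow> (c ^^ k) (eps (Suc m)) (Suc m) = 0"
      and cover: "\<And>a. a \<in> {Suc m..<Suc m + L} \<Longrightarrow>
        \<exists>k<L. \<exists>\<sigma>. (c ^^ k) (eps (Suc m)) = (\<lambda>l. \<sigma> * eps a l) \<and> \<sigma> \<in> {1, -1}"
      unfolding negacyclic_def by blast+
    have fix_m: "(c ^^ k) (eps (Suc m)) m = 0" for k
    proof (induction k)
      case (Suc k)
      have "c u m = u m" for u
        unfolding c_def by (rule word_B_outside[of _ "Suc m"]) (use zs in auto)
      then show ?case using Suc by simp
    qed (simp add: eps_def)
    have c_eps: "c (eps m) = eps m"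
      unfolding c_def by (rule word_B_eps_below[of _ "Suc m"]) (use zs in auto)
    have c_neg: "c (\<lambda>l. - u l) = (\<lambda>l. - c u l)" for u unfolding c_def by (rule word_element_uminus)
    have s_neg: "s m (\<lambda>l. - u l) = (\<lambda>l. - s m u l)" for u by (rule simple_reflection_uminus)
    have s_eps: "s m (eps m) = eps (Suc m)" "s m (eps (Suc m)) = eps m"
      using mn Suc.prems by (auto simp: reflection_B_swap eps_def)
    \<comment> \<open>Strictly inside the cycle the coordinates \<open>m\<close> and
      \<open>m + 1\<close> are both 0, so the swap does nothing.\<close>
    have s_fix: "s m ((c ^^ k) (eps (Suc m))) = (c ^^ k) (eps (Suc m))" if "0 < k" "k < L" for k
      using mn Suc.prems zero[OF that] fix_m[of k] by (auto simp: reflection_B_swap)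
    have comm: "?W xs \<circ> s m = s m \<circ> ?W xs" if "set xs \<subseteq> {Suc (Suc m)..n}" for xs
      by (rule reflection_commute_word) (use that mn Suc.prems in \<open>auto simp: adjacent_B\<close>)
    have tail: "{Suc m..n} - {Suc m} = {Suc (Suc m)..n}" by auto
    have L: "Suc (L - 1) = L" using L_pos by simp
    \<comment> \<open>Only the letter \<open>m + 1\<close> fails to commute with \<open>m\<close>.
      If it stands to the right, \<open>s m\<close> moves to the left end and \<open>t = 0\<close>;
      if to the left, \<open>s m\<close> moves to the right end, acts first, and the orbit is
      shifted by \<open>t = 1\<close>.\<close>
    obtain t :: nat where t: "t = 0 \<or> t = 1"
      and y: "\<And>k. k < L \<Longrightarrow> (?W ws ^^ Suc k) (eps m) = (c ^^ (k + t)) (eps (Suc m))"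
      and y_last: "(?W ws ^^ Suc L) (eps m) = (\<lambda>l. - eps m l)"
    proof (cases "Suc m \<in> set vs")
      case True
      then have "set us \<subseteq> {Suc (Suc m)..n}" using zs unfolding tail[symmetric] by auto
      then have c': "?W ws = s m \<circ> c"
        using comm[of us] unfolding ws c_def by (simp add: fun_eq_iff)
      have y: "(?W ws ^^ Suc k) (eps m) = (c ^^ k) (eps (Suc m))" if "k < L" for k
        using that
      proof (induction k)
        case (Suc k)
        have "(?W ws ^^ Suc (Suc k)) (eps m) = s m (c ((?W ws ^^ Suc k) (eps m)))"
          by (simp only: funpow.simps comp_apply c')
        also have "\<dots> = s m ((c ^^ Suc k) (eps (Suc m)))"
          unfolding Suc.IH[OF Suc_lessD[OF Suc.prems]] by simp
        also have "\<dots> = (c ^^ Suc k) (eps (Suc m))"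
          by (rule s_fix) (use Suc.prems in auto)
        finally show ?case .
      qed (simp add: c' c_eps s_eps)
      have "(?W ws ^^ Suc L) (eps m) = s m (c ((?W ws ^^ Suc (L - 1)) (eps m)))"
        using L by (simp add: c')
      also have "\<dots> = s m (c ((c ^^ (L - 1)) (eps (Suc m))))" using L_pos y[of "L - 1"] by simp
      also have "\<dots> = s m ((c ^^ Suc (L - 1)) (eps (Suc m)))" by simp
      also have "\<dots> = (\<lambda>l. - eps m l)" unfolding L neg s_neg s_eps ..
      finally show ?thesis using that[of 0] y by simp
    next
      case False
      then have "set vs \<subseteq> {Suc (Suc m)..n}" using zs unfolding tail[symmetric] by auto
      then have c': "?W ws = c \<circ> s m"
        by (simp only: ws c_def word_element_append word_element_Cons comp_assoc comm)
      have y: "(?W ws ^^ Suc k) (eps m) = (c ^^ Suc k) (eps (Suc m))" if "k < L" for k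
        using that
      proof (induction k)
        case (Suc k)
        have "(?W ws ^^ Suc (Suc k)) (eps m) = c (s m ((?W ws ^^ Suc k) (eps m)))"
          by (simp only: funpow.simps comp_apply c')
        also have "\<dots> = c (s m ((c ^^ Suc k) (eps (Suc m))))"
          by (simp only: Suc.IH[OF Suc_lessD[OF Suc.prems]])
        also have "s m ((c ^^ Suc k) (eps (Suc m))) = (c ^^ Suc k) (eps (Suc m))"
          by (rule s_fix) (use Suc.prems in auto)
        finally show ?case by simp
      qed (simp add: c' s_eps)
      have "(?W ws ^^ Suc L) (eps m) = c (s m ((?W ws ^^ Suc (L - 1)) (eps m)))"
        using L by (simp add: c')
      also have "\<dots> = c (s m ((c ^^ Suc (L - 1)) (eps (Suc m))))" using y[of "L - 1"] L_pos by simp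
      also have "\<dots> = (\<lambda>l. - eps m l)" unfolding L neg s_neg s_eps c_neg c_eps ..
      finally show ?thesis using that[of 1] y by simp
    qed
    show ?thesis
      unfolding negacyclic_def
    proof (intro conjI allI ballI impI)
      show "(?W ws ^^ Suc L) (eps m) = (\<lambda>l. - eps m l)" by (rule y_last)
    next
      fix k assume k: "0 < k \<and> k < Suc L"
      then have "(?W ws ^^ Suc (k - 1)) (eps m) = (c ^^ (k - 1 + t)) (eps (Suc m))"
        using t by (intro y) auto
      then show "(?W ws ^^ k) (eps m) m = 0" using k fix_m by simp
    next
      fix a assume a: "a \<in> {m..<m + Suc L}"
      show "\<exists>k<Suc L. \<exists>\<sigma>. (?W ws ^^ k) (eps m) = (\<lambda>l. \<sigma> * eps a l) \<and> \<sigma> \<in> {1, -1}"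
      proof (cases "a = m")
        case True
        then show ?thesis by (intro exI[of _ 0] conjI exI[of _ 1]) auto
      next
        case a': False
        then obtain k \<sigma> where k: "k < L" "(c ^^ k) (eps (Suc m)) = (\<lambda>l. \<sigma> * eps a l)" "\<sigma> \<in> {1, -1}"
          using cover[of a] a by auto
        show ?thesis
        proof (cases "t \<le> k")
          case True
          then have "(?W ws ^^ Suc (k - t)) (eps m) = (\<lambda>l. \<sigma> * eps a l)"
            using y[of "k - t"] k by simp
          then show ?thesis using k by (intro exI[of _ "Suc (k - t)"]) auto
        next
          case False
          \<comment> \<open>The shifted orbit starts at exponent 1 and misses
            \<open>eps (Suc m)\<close> itself, but at exponent \<open>L\<close> it reaches its
            negative.\<close>
          then have "t = 1" "k = 0" using t by auto
          then have "eps (Suc m) = (\<lambda>l. \<sigma> * eps a l)" using k by simp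
          then have "(?W ws ^^ Suc (L - 1)) (eps m) = (\<lambda>l. - \<sigma> * eps a l)"
            using y[of "L - 1"] L neg \<open>t = 1\<close> k(1) by simp
          then have "(?W ws ^^ L) (eps m) = (\<lambda>l. - \<sigma> * eps a l)" unfolding L .
          then show ?thesis using k(3) by (intro exI[of _ L] conjI exI[of _ "- \<sigma>"]) auto
        qed
      qed
    qed
  qed
qed simp

text \<open>The \<open>n\<close>-th power commutes with the Coxeter element and negates
  \<open>eps 1\<close>, hence it negates the whole orbit, which contains every \<open>eps k\<close>
  up to sign.\<close>

lemma coxeter_power_B:
  assumes "n \<ge> 1" "distinct ws" "set ws = {1..n}"
  shows "(word_element (type_B n) ws ^^ n) v = (\<lambda>k. if k \<in> {1..n} then - v k else v k)"
proof
  fix k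
  let ?c = "word_element (type_B n) ws"
  define T where "T = ?c ^^ n"
  interpret dynkin_datum "type_B n" using assms by (intro dynkin_datum_B)
  define xs where "xs = concat (replicate n ws)"
  have T: "T = W xs" by (simp add: T_def xs_def word_element_power)
  have xs: "set xs \<subseteq> {1..n}" using assms(3) by (auto simp: xs_def)
  show "(?c ^^ n) v k = (if k \<in> {1..n} then - v k else v k)"
  proof (cases "k \<in> {1..n}")
    case False
    then show ?thesis
      using word_B_outside[OF xs, of k v] assms(1) by (auto simp flip: T T_def)
  next
    case True
    have cyc: "negacyclic ?c 1 n" using assms by (intro negacyclic_B) auto
    moreover have "k \<in> {1..<1 + n}" using True by simp
    ultimately obtain j \<sigma> where j: "(?c ^^ j) (eps 1) = (\<lambda>l. \<sigma> * eps k l)" "\<sigma> \<in> {1, -1}"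
      unfolding negacyclic_def by meson
    have "T (\<lambda>l. \<sigma> * eps k l) = (?c ^^ (n + j)) (eps 1)"
      by (simp only: T_def funpow_add comp_apply j(1))
    also have "\<dots> = (?c ^^ j) ((?c ^^ n) (eps 1))"
      by (subst add.commute) (simp only: funpow_add comp_apply)
    also have "\<dots> = (?c ^^ j) (\<lambda>l. - eps 1 l)" using cyc by (simp add: negacyclic_def)
    also have "\<dots> = (\<lambda>l. - (\<sigma> * eps k l))" unfolding word_element_power word_element_uminus
      by (simp only: j(1) flip: word_element_power)
    finally have "(\<lambda>l. \<sigma> * T (eps k) l) = (\<lambda>l. - (\<sigma> * eps k l))" unfolding T word_element_scale .
    then have "\<sigma> * T (eps k) l = - (\<sigma> * eps k l)" for l by (rule fun_cong)
    then have "T (eps k) l = - eps k l" for l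
      using j(2) by (metis empty_iff insert_iff mult_cancel_left mult_minus_right
          neg_equal_0_iff_equal zero_neq_one)
    then have Teps: "T (eps k) = (\<lambda>l. - eps k l)" by (rule ext)
    \<comment> \<open>The coordinate of the image of a general \<open>v\<close> is read off by
      invariance of the inner product.\<close>
    have "v k = inner_prod (type_B n) (eps k) v" using True by (simp add: inner_prod_eps)
    also have "\<dots> = inner_prod (type_B n) (T (eps k)) (T v)"
      unfolding T using xs by (simp add: inner_prod_word)
    also have "\<dots> = - T v k"
      using inner_prod_lincomb[of "type_B n" "T v" "-1" "eps k" 0 "eps k"] True
      by (simp add: Teps inner_prod_commute[of _ "T v"]) (simp add: inner_prod_eps inner_prod_commute[of _ "T v"])
    finally show ?thesis using True by (simp add: T_def)
  qed
qed

text \<open>For \<open>k < n\<close> coordinate 1 is 0; for larger \<open>k\<close> the vector is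
  the negative of one from the first half of the cycle, so coordinate 1 is 0 or -1.\<close>

lemma coxeter_order_B:
  assumes "n \<ge> 1" "distinct ws" "set ws = {1..n}" "0 < k" "k < 2 * n"
  shows "(word_element (type_B n) ws ^^ k) (eps 1) 1 \<noteq> 1"
proof -
  let ?c = "word_element (type_B n) ws"
  have cyc: "negacyclic ?c 1 n" using assms by (intro negacyclic_B) auto
  show ?thesis
  proof (cases "k < n")
    case True
    then show ?thesis using cyc assms(4) by (simp add: negacyclic_def)
  next
    case False
    define j where "j = k - n"
    have j: "k = j + n" "j < n" using False assms(5) by (simp_all add: j_def)
    have "(?c ^^ k) (eps 1) 1 = (?c ^^ j) (\<lambda>l. - eps 1 l) 1"
      using cyc by (simp add: j(1) funpow_add negacyclic_def)
    also have "\<dots> = - (?c ^^ j) (eps 1) 1" unfolding word_element_power word_element_uminus ..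
    also have "\<dots> \<noteq> 1"
      using cyc j(2) by (cases "j = 0") (auto simp: negacyclic_def eps_def)
    finally show ?thesis .
  qed
qed

section \<open>Folding type D onto type B\<close>

definition unfold_word :: "nat \<Rightarrow> nat list \<Rightarrow> nat list" where
  "unfold_word n ws = concat (map (\<lambda>i. if i = n then [n, n + 1] else [i]) ws)"

lemma unfold_word_simps [simp]:
  "unfold_word n [] = []"
  "unfold_word n (i # ws) = (if i = n then [n, n + 1] else [i]) @ unfold_word n ws"
  "unfold_word n (us @ vs) = unfold_word n us @ unfold_word n vs"
  by (simp_all add: unfold_word_def)

lemma set_unfold_word: "set (unfold_word n ws) = set ws \<union> (if n \<in> set ws then {n + 1} else {})"
  by (induction ws) auto

lemma unfold_word_id: "n \<notin> set ws \<Longrightarrow> unfold_word n ws = ws"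
  by (induction ws) auto

text \<open>In type D the letters \<open>n, n + 1\<close> together negate the coordinates
  \<open>n\<close> and \<open>n + 1\<close>, while letters below \<open>n\<close> act alike in both
  types. Since \<open>n\<close> occurs at most once, so does the sign change of the last
  coordinate.\<close>

lemma word_unfold:
  assumes "n \<ge> 1" "distinct ws" "set ws \<subseteq> {1..n}"
  shows "word_element (type_D_Suc n) (unfold_word n ws) v =
    (word_element (type_B n) ws v)(n + 1 := (if n \<in> set ws then - v (n + 1) else v (n + 1)))"
  using assms(2,3)
proof (induction ws)
  case (Cons i ws)
  let ?u = "word_element (type_B n) ws v"
  show ?case
  proof (cases "i = n")
    case True
    then have "word_element (type_D_Suc n) (unfold_word n ws) v = ?u(n + 1 := v (n + 1))"
      using Cons by (auto simp: fun_upd_def)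
    then show ?thesis
      using True Cons.prems assms(1) reflection_D_last[of n]
      by (auto simp: reflection_D_swap reflection_B_last fun_eq_iff)
  next
    case False
    then show ?thesis
      using Cons by (auto simp: reflection_D_swap reflection_B_swap)
  qed
qed auto

lemma coxeter_power_D:
  assumes "n \<ge> 1" "distinct ws" "set ws = {1..n}"
  shows "(word_element (type_D_Suc n) (unfold_word n ws) ^^ k) v =
    ((word_element (type_B n) ws ^^ k) v)(n + 1 := (-1) ^ k * v (n + 1))"
proof (induction k)
  case (Suc k)
  let ?c = "word_element (type_B n) ws" and ?d = "word_element (type_D_Suc n) (unfold_word n ws)"
  let ?u = "(?c ^^ k) v" and ?x = "(-1) ^ k * v (n + 1)"
  have "(?d ^^ Suc k) v = ?d (?u(n + 1 := ?x))"
    by (simp only: funpow.simps comp_apply Suc)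
  also have "\<dots> = (?c (?u(n + 1 := ?x)))(n + 1 := - ?x)"
    using assms by (subst word_unfold) auto
  also have "\<dots> = (?c ?u)(n + 1 := - ?x)" using assms(3) by (simp add: word_B_upd[of ws n, simplified])
  finally show ?case by simp
qed simp

section \<open>Coxeter numbers\<close>

lemma coxeter_number_B:
  assumes "n \<ge> 1" shows "coxeter_number (type_B n) = 2 * n"
  unfolding coxeter_number_def type_B_simps(2)
proof (rule Least_equality)
  let ?c = "word_element (type_B n) (sorted_list_of_set {1..n})"
  have l: "distinct (sorted_list_of_set {1..n})" "set (sorted_list_of_set {1..n}) = {1..n}" by auto
  have "(?c ^^ (n + n)) v = v" for v
    using coxeter_power_B[OF assms l] unfolding funpow_add by (auto simp: fun_eq_iff)
  then show "0 < 2 * n \<and> ?c ^^ (2 * n) = id" using assms by (simp add: fun_eq_iff mult_2)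
  fix k assume k: "0 < k \<and> ?c ^^ k = id"
  then have one: "(?c ^^ k) (eps 1) 1 = 1" by (simp add: eps_def)
  show "2 * n \<le> k"
  proof (rule ccontr)
    assume "\<not> 2 * n \<le> k"
    then have "k < 2 * n" by simp
    from coxeter_order_B[OF assms l conjunct1[OF k] this] one show False by contradiction
  qed
qed

text \<open>The Coxeter number is defined by the increasing product of the nodes; this word is
  itself an unfolded word of type B.\<close>

lemma sorted_nodes_D: "sorted_list_of_set {1..n + 1} = unfold_word n [1..<Suc n]" if "n \<ge> 1"
proof -
  have "{1..n + 1} = {1..<Suc (Suc n)}" by auto
  then have "sorted_list_of_set {1..n + 1} = [1..<Suc (Suc n)]"
    by (simp only: sorted_list_of_set_range)
  then have "sorted_list_of_set {1..n + 1} = [1..<n] @ [n, n + 1]" using that by simp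
  moreover have "[1..<Suc n] = [1..<n] @ [n]" using that by simp
  ultimately show ?thesis by (simp add: unfold_word_id)
qed

text \<open>The two Coxeter numbers agree: coordinate 1 already forces the order of type B, and the
  even power \<open>2 * n\<close> also restores the last coordinate.\<close>

lemma coxeter_number_D:
  assumes "n \<ge> 1" shows "coxeter_number (type_D_Suc n) = 2 * n"
  unfolding coxeter_number_def
proof (rule Least_equality)
  let ?c = "word_element (type_D_Suc n) (sorted_list_of_set (nodes (type_D_Suc n)))"
  have l: "distinct [1..<Suc n]" "set [1..<Suc n] = {1..n}" by auto
  have c: "?c = word_element (type_D_Suc n) (unfold_word n [1..<Suc n])"
    using sorted_nodes_D[OF assms] by simp
  have "(?c ^^ (2 * n)) v = v" for v
  proof -
    have "(word_element (type_B n) [1..<Suc n] ^^ (n + n)) v = v"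
      using coxeter_power_B[OF assms l] unfolding funpow_add by (auto simp: fun_eq_iff)
    then show ?thesis unfolding c coxeter_power_D[OF assms l] by (simp add: mult_2)
  qed
  then show "0 < 2 * n \<and> ?c ^^ (2 * n) = id" using assms by (simp add: fun_eq_iff)
  fix k assume k: "0 < k \<and> ?c ^^ k = id"
  have "(word_element (type_B n) [1..<Suc n] ^^ k) (eps 1) 1 = (?c ^^ k) (eps 1) 1"
    unfolding c coxeter_power_D[OF assms l] using assms by simp
  also have "\<dots> = 1" using k by (simp add: eps_def)
  finally have one: "(word_element (type_B n) [1..<Suc n] ^^ k) (eps 1) 1 = 1" .
  show "2 * n \<le> k"
  proof (rule ccontr)
    assume "\<not> 2 * n \<le> k"
    then have "k < 2 * n" by simp
    from coxeter_order_B[OF assms l conjunct1[OF k] this] one show False by contradiction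
  qed
qed

section \<open>Longest elements and diagram involutions\<close>

lemma coxeter_power_B_root:
  assumes "n \<ge> 1" "distinct ws" "set ws = {1..n}" "\<beta> \<in> positive_roots_B n"
  shows "(word_element (type_B n) ws ^^ n) \<beta> = (\<lambda>k. - \<beta> k)"
proof -
  have "\<beta> k = 0" if "k \<notin> {1..n}" for k
    using assms(4) that by (auto simp: positive_roots_B_def root_pairs_def root_pair_def eps_def)
  then show ?thesis unfolding coxeter_power_B[OF assms(1-3)] by auto
qed

lemma coxeter_power_in_weyl_group:
  assumes "set ws \<subseteq> nodes C" shows "word_element C ws ^^ k \<in> weyl_group C"
proof -
  have "concat (replicate k ws) \<in> lists (nodes C)" using assms by auto
  then show ?thesis unfolding word_element_power weyl_group_def by blast
qed

lemma involution_B: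
  assumes "n \<ge> 1" "i \<in> {1..n}" shows "involution (type_B n) i = i"
proof -
  interpret positive_system "type_B n" "positive_roots_B n" using assms(1) by (rule positive_system_B)
  obtain ws where ws: "distinct ws" "set ws = {1..n}" using finite_distinct_list by blast
  let ?w = "word_element (type_B n) ws ^^ n"
  have neg: "?w \<beta> = (\<lambda>k. - \<beta> k)" if "\<beta> \<in> positive_roots_B n" for \<beta>
    using assms(1) ws that by (rule coxeter_power_B_root)
  have "longest_element (type_B n) = ?w"
  proof (rule longest_element_eq)
    show "?w \<in> weyl_group (type_B n)" using ws by (intro coxeter_power_in_weyl_group) simp
  qed (simp add: neg)
  then show ?thesis
    using assms(2) neg[OF simple_in_P[of i]] by (intro involution_eq) auto
qed

text \<open>The \<open>n\<close>-th power of the unfolded Coxeter element negates the first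
  \<open>n\<close> coordinates and multiplies the last by \<open>(-1) ^ n\<close>. It inverts all
  positive roots, and for even \<open>n\<close> it exchanges the two end nodes up to sign.\<close>

lemma involution_D:
  assumes "n \<ge> 2" "i \<in> {1..n}"
  shows "involution (type_D_Suc n) i = (if i = n \<and> odd (n + 1) then n + 1 else i)"
proof -
  interpret positive_system "type_D_Suc n" "root_pairs (n + 1)" using assms(1) by (rule positive_system_D)
  obtain ws where ws: "distinct ws" "set ws = {1..n}" using finite_distinct_list by blast
  let ?w = "word_element (type_D_Suc n) (unfold_word n ws) ^^ n"
  have w: "?w v = (\<lambda>k. if k \<in> {1..n} then - v k else if k = n + 1 then (-1) ^ n * v k else v k)" for v
  proof -
    have "n \<ge> 1" using assms(1) by simp
    then show ?thesis using ws by (simp add: coxeter_power_D coxeter_power_B fun_eq_iff)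
  qed
  have neg: "(\<lambda>k. - ?w \<beta> k) \<in> root_pairs (n + 1)" if \<beta>: "\<beta> \<in> root_pairs (n + 1)" for \<beta>
  proof -
    obtain a \<sigma> b where v: "\<beta> = root_pair a \<sigma> b" "1 \<le> a" "a < b" "b \<le> n + 1" "\<sigma> \<in> {1, -1}"
      using \<beta> by (auto simp: root_pairs_def)
    have "(\<lambda>k. - ?w \<beta> k) = root_pair a (if b \<le> n then \<sigma> else - ((-1) ^ n) * \<sigma>) b"
      unfolding w using v by (auto simp: root_pair_def eps_def)
    moreover have "(-1) ^ n = (1::real) \<or> (-1) ^ n = (-1::real)" by (cases "even n") auto
    ultimately show ?thesis using v by (auto intro!: root_pairsI)
  qed
  have "longest_element (type_D_Suc n) = ?w"
    using assms(1) ws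
    by (intro longest_element_eq coxeter_power_in_weyl_group neg) (simp_all add: set_unfold_word)
  then have "longest_element (type_D_Suc n) (\<alpha> i)
      = (\<lambda>k. - \<alpha> (if i = n \<and> odd (n + 1) then n + 1 else i) k)"
    using assms unfolding w by (auto simp: w root_pair_def eps_def fun_eq_iff)
  then show ?thesis using assms by (intro involution_eq) (auto split: if_splits)
qed

section \<open>Labels along a repeated adapted word\<close>

context dynkin_datum
begin

text \<open>Heights of adjacent nodes differ, so a weak descent between them is strict.\<close>

lemma height_sorted_imp_compatible:
  assumes "dynkin_quiver C \<xi>" "sorted_wrt (\<lambda>i j. \<xi> i \<ge> \<xi> j) ws"
  shows "compatible \<xi> ws"
  using assms(2) unfolding compatible_def
  by (rule sorted_wrt_mono_rel[rotated]) (use assms(1) in \<open>force simp: dynkin_quiver_def\<close>)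

end

lemma label_B_positive:
  assumes "n \<ge> 1" "distinct (us @ i # vs)" "set (us @ i # vs) = {1..n}" "k < n"
  defines "\<tau> \<equiv> word_element (type_B n) (us @ i # vs)"
  shows "(\<tau> ^^ k) (word_element (type_B n) us (simple_root (type_B n) i)) \<in> positive_roots_B n"
proof -
  interpret positive_system "type_B n" "positive_roots_B n" using assms(1) by (rule positive_system_B)
  let ?ws = "us @ i # vs"
  let ?rep = "\<lambda>k. concat (replicate k ?ws)"
  let ?as = "?rep k @ us" and ?bs = "vs @ ?rep (n - Suc k)"
  \<comment> \<open>Cut the \<open>n\<close>-fold word at the letter \<open>i\<close> of block
    number \<open>k\<close>, counted from 0: the prefix before it is the word that produces the
    label.\<close>
  have "replicate n ?ws = replicate k ?ws @ ?ws # replicate (n - Suc k) ?ws"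
    using assms(4) by (metis Suc_diff_Suc add_diff_inverse_nat less_imp_le_nat not_less replicate_Suc replicate_add)
  then have split: "?rep n = ?as @ i # ?bs" by simp
  have "(\<lambda>k. - (\<tau> ^^ n) \<beta> k) = \<beta>" if "\<beta> \<in> positive_roots_B n" for \<beta>
    unfolding \<tau>_def coxeter_power_B_root[OF assms(1-3) that] by simp
  then have "inversions (\<tau> ^^ n) = positive_roots_B n" by (auto simp: inversions_def)
  moreover have "length (?rep n) = n * n"
    using distinct_card[OF assms(2)] assms(3) by (simp add: length_concat sum_list_replicate)
  moreover have sub: "set (?rep n) \<subseteq> nodes (type_B n)" using assms(3) by auto
  moreover have "W (?rep n) = \<tau> ^^ n" unfolding \<tau>_def word_element_power ..
  \<comment> \<open>The length bounds the number of inversions by \<open>n * n\<close> from above,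
    the count of positive roots bounds it from below.\<close>
  ultimately have "card (inversions (W (?rep n))) = length (?rep n)"
    using card_inversions_le_length[OF sub] card_positive_roots_B[of n] by (metis le_antisym)
  then have "W ?as (\<alpha> i) \<in> positive_roots_B n"
    using sub unfolding split by (intro prefix_root_positive)
  then show ?thesis
    unfolding \<tau>_def word_element_power by (simp only: word_element_append comp_apply)
qed

lemma ar_vertices_B:
  assumes "n \<ge> 1"
  shows "ar_vertices (type_B n) \<xi> =
    {(i, p). i \<in> {1..n} \<and> even (p - \<xi> i) \<and> \<xi> i - 2 * int n < p \<and> p \<le> \<xi> i}"
  unfolding ar_vertices_def using assms by (auto simp: involution_B coxeter_number_B)

text \<open>The involution may exchange \<open>n\<close> and \<open>n + 1\<close>, but the heights
  there coincide, so the lower bound on \<open>p\<close> is the one of type B.\<close>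

lemma ar_vertices_D:
  assumes "n \<ge> 2" "\<xi> n = \<xi> (n + 1)"
  shows "{x \<in> ar_vertices (type_D_Suc n) \<xi>. fst x \<le> n} =
    {(i, p). i \<in> {1..n} \<and> even (p - \<xi> i) \<and> \<xi> i - 2 * int n < p \<and> p \<le> \<xi> i}"
  unfolding ar_vertices_def using assms
  by (auto simp: involution_D coxeter_number_D split: if_splits)

text \<open>Only the existence of arrows is compared: the double bond of type B gives two arrows
  from residue \<open>n\<close> to residue \<open>n - 1\<close> where type D has one.\<close>

lemma ar_arrows_positive_iff:
  assumes "n \<ge> 2" "x \<in> ar_vertices (type_B n) \<xi>'" "y \<in> ar_vertices (type_B n) \<xi>'"
    and "x \<in> ar_vertices (type_D_Suc n) \<xi>" "y \<in> ar_vertices (type_D_Suc n) \<xi>"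
  shows "ar_arrows (type_B n) \<xi>' x y > 0 \<longleftrightarrow> ar_arrows (type_D_Suc n) \<xi> x y > 0"
proof -
  obtain i p j q where xy: "x = (i, p)" "y = (j, q)" by (metis surj_pair)
  have ij: "i \<le> n" "j \<le> n" using assms(2,3) by (simp_all add: xy ar_vertices_def)
  have "coroot_pairing (type_B n) i (simple_root (type_B n) j) \<le> -1"
    and "coroot_pairing (type_D_Suc n) i (simple_root (type_D_Suc n) j) \<le> -1"
    if "adjacent (type_B n) i j"
    using that assms(1) by (auto simp: adjacent_B pairing_B pairing_D eps_def root_pair_def)
  then have "0 < nat \<lfloor>- coroot_pairing (type_B n) i (simple_root (type_B n) j)\<rfloor>"
    and "0 < nat \<lfloor>- coroot_pairing (type_D_Suc n) i (simple_root (type_D_Suc n) j)\<rfloor>"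
    if "adjacent (type_B n) i j"
    using that unfolding zero_less_nat_eq zero_less_floor by force+
  then show ?thesis
    using assms(2-5) adjacent_D[OF assms(1) ij]
    by (simp add: ar_arrows_def xy del: type_B_simps type_D_simps)
qed

text \<open>One word serves both types: list the nodes \<open>1..n\<close> by descending height.
  Inserting \<open>n + 1\<close> after \<open>n\<close> keeps the list descending because the two
  heights agree. The entry -1 comes from \<open>\<alpha> n\<close>, which is
  \<open>eps n - eps (n + 1)\<close> in type D and \<open>eps n\<close> in type B.\<close>

lemma folded_labels:
  assumes n: "n \<ge> 2"
    and D: "dynkin_quiver (type_D_Suc n) \<xi>" and eq: "\<xi> n = \<xi> (n + 1)"
    and B: "dynkin_quiver (type_B n) \<xi>'" and \<xi>': "\<forall>i\<in>{1..n}. \<xi>' i = \<xi> i"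
    and i: "i \<in> {1..n}"
  obtains us vs where "distinct (us @ i # vs)" "set (us @ i # vs) = {1..n}"
    "quiver_coxeter (type_B n) \<xi>' = word_element (type_B n) (us @ i # vs)"
    "quiver_coxeter (type_D_Suc n) \<xi> = word_element (type_D_Suc n) (unfold_word n (us @ i # vs))"
    "gamma_root (type_B n) \<xi>' i = word_element (type_B n) us (simple_root (type_B n) i)"
    "gamma_root (type_D_Suc n) \<xi> i =
      (gamma_root (type_B n) \<xi>' i)(n + 1 := (if i = n then -1 else 0))"
proof -
  interpret B: dynkin_datum "type_B n" using n by (intro dynkin_datum_B) simp
  interpret D: dynkin_datum "type_D_Suc n" using n by (intro dynkin_datum_D)
  define ws where "ws = sort_key (\<lambda>i. - \<xi> i) [1..<Suc n]"
  have ws: "distinct ws" "set ws = {1..n}" by (auto simp: ws_def)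
  have "sorted (map (\<lambda>i. - \<xi> i) ws)" unfolding ws_def by (rule sorted_sort_key)
  then have desc: "sorted_wrt (\<lambda>i j. \<xi> i \<ge> \<xi> j) ws" by (simp add: sorted_map)
  have desc': "sorted_wrt (\<lambda>i j. \<xi>' i \<ge> \<xi>' j) ws"
    by (rule sorted_wrt_mono_rel[OF _ desc]) (use \<xi>' ws in auto)
  have fullB: "B.full_word ws" using ws by (simp add: B.full_word_def)
  have compB: "B.compatible \<xi>' ws" using B desc' by (rule B.height_sorted_imp_compatible)
  have "n \<in> set ws" using ws n by simp
  then obtain as bs where asbs: "ws = as @ n # bs" using split_list by metis
  have "n \<notin> set as" "n \<notin> set bs" using ws(1) unfolding asbs by auto
  then have unf: "unfold_word n ws = as @ n # (n + 1) # bs"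
    unfolding asbs by (simp add: unfold_word_id)
  have "n + 1 \<notin> set ws" using ws by simp
  then have "distinct (unfold_word n ws)"
    using ws(1) unfolding unf unfolding asbs by auto
  moreover have "set (unfold_word n ws) = {1..n + 1}"
    using \<open>n \<in> set ws\<close> ws by (auto simp: set_unfold_word)
  ultimately have fullD: "D.full_word (unfold_word n ws)" by (simp add: D.full_word_def)
  have "sorted_wrt (\<lambda>i j. \<xi> i \<ge> \<xi> j) (unfold_word n ws)"
    using desc eq unfolding unf unfolding asbs by (auto simp: sorted_wrt_append)
  with D have compD: "D.compatible \<xi> (unfold_word n ws)" by (rule D.height_sorted_imp_compatible)
  have "i \<in> set ws" using ws i by simp
  then obtain us vs where split: "ws = us @ i # vs" using split_list by metis
  have us: "set us \<subseteq> {1..n}" "distinct us" "i \<notin> set us" using ws unfolding split by auto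
  have gB: "gamma_root (type_B n) \<xi>' i = B.W us (simple_root (type_B n) i)"
    using B fullB compB unfolding split by (rule B.gamma_root_eq)
  obtain vs' where "unfold_word n ws = unfold_word n us @ i # vs'"
    unfolding split by (cases "i = n") auto
  then have "gamma_root (type_D_Suc n) \<xi> i = D.W (unfold_word n us) (simple_root (type_D_Suc n) i)"
    using D fullD compD by (metis D.gamma_root_eq)
  also have "\<dots> = (B.W us (simple_root (type_D_Suc n) i))
      (n + 1 := (if n \<in> set us then - simple_root (type_D_Suc n) i (n + 1)
        else simple_root (type_D_Suc n) i (n + 1)))"
    using n us by (intro word_unfold) auto
  also have "simple_root (type_D_Suc n) i
      = (simple_root (type_B n) i)(n + 1 := (if i = n then -1 else 0))"
    using i by (auto simp: root_pair_def eps_def)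
  \<comment> \<open>For \<open>i = n\<close> the letter \<open>n\<close> does not occur in
    \<open>us\<close>, so -1 survives; for other \<open>i\<close> the entry is 0 and a sign change
    is invisible.\<close>
  finally have "gamma_root (type_D_Suc n) \<xi> i =
      (gamma_root (type_B n) \<xi>' i)(n + 1 := (if i = n then -1 else 0))"
    unfolding word_B_upd[OF us(1)] gB using us(3) by (auto simp: fun_eq_iff)
  with gB show ?thesis
    using that[of us vs] ws B.quiver_coxeter_eq[OF B fullB compB] D.quiver_coxeter_eq[OF D fullD compD]
    unfolding split by blast
qed

text \<open>Words preserve norms, so the type B label is short exactly at residue \<open>n\<close>.
  The type D label can differ from it only in coordinate \<open>n + 1\<close>, where it has a sign
  at residue \<open>n\<close> and 0 elsewhere.\<close>

lemma folded_label_cases: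
  assumes n: "n \<ge> 2"
    and D: "dynkin_quiver (type_D_Suc n) \<xi>" and eq: "\<xi> n = \<xi> (n + 1)"
    and B: "dynkin_quiver (type_B n) \<xi>'" and \<xi>': "\<forall>i\<in>{1..n}. \<xi>' i = \<xi> i"
    and x: "x \<in> ar_vertices (type_B n) \<xi>'"
  shows "(fst x = n \<and>
        (\<exists>a\<in>{1..n}. \<exists>\<sigma>\<in>{1, -1}.
           ar_label (type_D_Suc n) \<xi> x = root_pair a \<sigma> (n + 1) \<and>
           ar_label (type_B n) \<xi>' x = eps a)) \<or>
       (\<exists>a b. \<exists>\<sigma>\<in>{1, -1}. 1 \<le> a \<and> a < b \<and> b \<le> n \<and>
           ar_label (type_D_Suc n) \<xi> x = root_pair a \<sigma> b \<and>
           ar_label (type_B n) \<xi>' x = root_pair a \<sigma> b)"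
proof -
  obtain i p where ip: "x = (i, p)" by (cases x)
  have n1: "n \<ge> 1" using n by simp
  have i: "i \<in> {1..n}" and p: "\<xi> i - 2 * int n < p"
    using x \<xi>' unfolding ip ar_vertices_B[OF n1] by auto
  define k where "k = nat ((\<xi> i - p) div 2)"
  \<comment> \<open>The strict lower bound on \<open>p\<close> yields exactly the exponents for
    which \<open>label_B_positive\<close> applies.\<close>
  have k: "k < n" using p n unfolding k_def by linarith
  obtain us vs where w: "distinct (us @ i # vs)" "set (us @ i # vs) = {1..n}"
    "quiver_coxeter (type_B n) \<xi>' = word_element (type_B n) (us @ i # vs)"
    "quiver_coxeter (type_D_Suc n) \<xi> = word_element (type_D_Suc n) (unfold_word n (us @ i # vs))"
    "gamma_root (type_B n) \<xi>' i = word_element (type_B n) us (simple_root (type_B n) i)"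
    "gamma_root (type_D_Suc n) \<xi> i =
      (gamma_root (type_B n) \<xi>' i)(n + 1 := (if i = n then -1 else 0))"
    using folded_labels[OF n D eq B \<xi>' i] .
  let ?\<tau> = "word_element (type_B n) (us @ i # vs)"
  define \<beta> where "\<beta> = (?\<tau> ^^ k) (gamma_root (type_B n) \<xi>' i)"
  have labB: "ar_label (type_B n) \<xi>' x = \<beta>"
    unfolding ar_label_def \<beta>_def w(3) k_def ip using \<xi>' i by simp
  let ?as = "concat (replicate k (us @ i # vs))"
  have as: "set ?as \<subseteq> {1..n}" "set (?as @ us) \<subseteq> {1..n}" using w(2) by auto
  have \<beta>_word: "\<beta> = word_element (type_B n) (?as @ us) (simple_root (type_B n) i)"
    unfolding \<beta>_def w(5) word_element_power by (simp only: word_element_append comp_apply)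
  have "ar_label (type_D_Suc n) \<xi> x = \<beta>(n + 1 := (-1) ^ k * (if i = n then -1 else 0))"
    unfolding ar_label_def ip fst_conv snd_conv k_def[symmetric] w(4) w(6)
    unfolding coxeter_power_D[OF n1 w(1,2)]
    unfolding \<beta>_def word_element_power word_B_upd[OF as(1)] by simp
  moreover have outside: "\<beta> (n + 1) = 0"
    unfolding \<beta>_word using word_B_outside[OF as(2), of "n + 1"] i
    by (auto simp: root_pair_def eps_def)
  ultimately have labD: "ar_label (type_D_Suc n) \<xi> x = \<beta>(n + 1 := (if i = n then - ((-1) ^ k) else 0))"
    by (simp add: fun_eq_iff)
  have \<beta>: "\<beta> \<in> positive_roots_B n"
    unfolding \<beta>_def w(5) by (rule label_B_positive[OF n1 w(1,2) k])
  interpret B: dynkin_datum "type_B n" using n1 by (rule dynkin_datum_B)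
  have norm: "inner_prod (type_B n) \<beta> \<beta> = (if i = n then 1 else 2)"
  proof -
    have "inner_prod (type_B n) \<beta> \<beta> =
      inner_prod (type_B n) (simple_root (type_B n) i) (simple_root (type_B n) i)"
      unfolding \<beta>_word using as(2) by (intro B.inner_prod_word) simp
    also have "\<dots> = (if i = n then 1 else 2)"
      unfolding inner_prod_B[OF i] by (simp add: root_pair_def eps_def)
    finally show ?thesis .
  qed
  from \<beta> consider (long) a \<sigma> b where "\<beta> = root_pair a \<sigma> b" "1 \<le> a" "a < b" "b \<le> n" "\<sigma> \<in> {1, -1}"
    | (short) a where "\<beta> = eps a" "a \<in> {1..n}"
    by (auto simp: positive_roots_B_def root_pairs_def)
  then show ?thesis
  proof cases
    case long
    have "inner_prod (type_B n) \<beta> \<beta> = 2"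
      unfolding long(1) using long(2-5)
      by (subst inner_prod_root_pair) (auto simp: root_pair_def eps_def)
    then have "i \<noteq> n" using norm by auto
    then have "ar_label (type_D_Suc n) \<xi> x = \<beta>" using labD outside by (auto simp: fun_eq_iff)
    with labB long show ?thesis
      by (intro disjI2 exI[of _ a] exI[of _ b] bexI[of _ \<sigma>]) simp_all
  next
    case short
    have "inner_prod (type_B n) \<beta> \<beta> = 1"
      unfolding short(1) using short(2) by (subst inner_prod_eps) (simp_all add: eps_def)
    then have "i = n" using norm by (simp split: if_splits)
    then have "ar_label (type_D_Suc n) \<xi> x = root_pair a (- ((-1) ^ k)) (n + 1)"
      using labD short by (auto simp: root_pair_def eps_def)
    moreover have "- ((-1) ^ k) \<in> {1, -1 :: real}" by (cases "even k") auto
    ultimately show ?thesis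
      using labB short \<open>i = n\<close> ip
      by (intro disjI1 conjI bexI[of _ a] bexI[of _ "- ((-1) ^ k)"]) simp_all
  qed
qed

theorem proposition5p4:
  fixes n :: nat and \<xi> \<xi>' :: "nat \<Rightarrow> int"
  assumes "n \<ge> 2"
    and "dynkin_quiver (type_D_Suc n) \<xi>"
    and "\<xi> n = \<xi> (n + 1)"
    and "dynkin_quiver (type_B n) \<xi>'"
    and "\<forall>i\<in>{1..n}. \<xi>' i = \<xi> i"
  shows "ar_vertices (type_B n) \<xi>' = {x \<in> ar_vertices (type_D_Suc n) \<xi>. fst x \<le> n} \<and>
    (\<forall>x\<in>ar_vertices (type_B n) \<xi>'. \<forall>y\<in>ar_vertices (type_B n) \<xi>'.
       ar_arrows (type_B n) \<xi>' x y > 0 \<longleftrightarrow> ar_arrows (type_D_Suc n) \<xi> x y > 0) \<and>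
    (\<forall>x\<in>ar_vertices (type_B n) \<xi>'.
       (fst x = n \<and>
        (\<exists>a\<in>{1..n}. \<exists>\<sigma>\<in>{1, -1}.
           ar_label (type_D_Suc n) \<xi> x = root_pair a \<sigma> (n + 1) \<and>
           ar_label (type_B n) \<xi>' x = eps a)) \<or>
       (\<exists>a b. \<exists>\<sigma>\<in>{1, -1}. 1 \<le> a \<and> a < b \<and> b \<le> n \<and>
           ar_label (type_D_Suc n) \<xi> x = root_pair a \<sigma> b \<and>
           ar_label (type_B n) \<xi>' x = root_pair a \<sigma> b))"
proof -
  have vertices: "ar_vertices (type_B n) \<xi>' = {x \<in> ar_vertices (type_D_Suc n) \<xi>. fst x \<le> n}"
    unfolding ar_vertices_D[OF assms(1,3)] using assms(1,5) by (auto simp: ar_vertices_B)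
  show ?thesis
  proof (intro conjI ballI)
    fix x y assume "x \<in> ar_vertices (type_B n) \<xi>'" "y \<in> ar_vertices (type_B n) \<xi>'"
    then show "ar_arrows (type_B n) \<xi>' x y > 0 \<longleftrightarrow> ar_arrows (type_D_Suc n) \<xi> x y > 0"
      using vertices by (intro ar_arrows_positive_iff[OF assms(1)]) auto
  qed (rule vertices, erule folded_label_cases[OF assms])
qed

end
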